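(* Let $n,p$ be positive integers. For any $\mathcal{A},\mathcal{B}\in\mathbb{H}^{n\times n\times p}_{++}$, the geodesic $\gamma:[0,1]\to\mathbb{H}^{n\times n\times p}_{++}$ from $\mathcal{A}$ to $\mathcal{B}$ in the Riemannian manifold $(\mathbb{H}^{n\times n\times p}_{++},g)$ is uniquely determined (up to parametrization), and is parametrized by $$\gamma(t)=\mathcal{A}^{1/2}*(\mathcal{A}^{-1/2}*\mathcal{B}*\mathcal{A}^{-1/2})^t*\mathcal{A}^{1/2}.$$
   Context: A tensor $\mathcal{A}\in\mathbb{C}^{m\times n\times p}$ has frontal slices $A^{(1)},\dots,A^{(p)}\in\mathbb{C}^{m\times n}$. $\operatorname{bcirc}(\mathcal{A})\in\mathbb{C}^{mp\times np}$ is the block circulant matrix whose $(j,l)$ block is $A^{(((j-l)\bmod p)+1)}$ (first block column $A^{(1)},\dots,A^{(p)}$); $\operatorname{unfold}(\mathcal{A})$ is the block column $A^{(1)},\dots,A^{(p)}$, and $\operatorname{fold}$ is its inverse. The T-product is $\mathcal{A}*\mathcal{B}=\operatorname{fold}(\operatorname{bcirc}(\mathcal{A})\cdot\operatorname{unfold}(\mathcal{B}))$; inverses are with respect to $*$ and the identity tensor $\mathcal{I}_{n,p}$ (first frontal slice $I_n$, others zero). The T-conjugate transpose $\mathcal{A}^H$ has frontal slices $(A^{(1)})^H,(A^{(p)})^H,\dots,(A^{(2)})^H$. $\mathbb{H}^{n\times n\times p}$ is the real vector space of T-Hermitian tensors ($\mathcal{A}\in\mathbb{C}^{n\times n\times p}$,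 $\mathcal{A}^H=\mathcal{A}$). With $\langle\mathcal{A},\mathcal{B}\rangle=\sum_{i,j,k}\overline{a_{ijk}}b_{ijk}$, $\mathbb{H}^{n\times n\times p}_{++}$ is the set of T-positive definite tensors, i.e. $\mathcal{A}\in\mathbb{H}^{n\times n\times p}$ with $\langle\mathcal{X},\mathcal{A}*\mathcal{X}\rangle>0$ for all nonzero $\mathcal{X}\in\mathbb{C}^{n\times1\times p}$ (equivalently, $\operatorname{bcirc}(\mathcal{A})$ is Hermitian positive definite). It is an open convex cone in $\mathbb{H}^{n\times n\times p}$ (topology of the Frobenius norm), hence a smooth manifold with $T_{\mathcal{P}}\mathbb{H}^{n\times n\times p}_{++}=\mathbb{H}^{n\times n\times p}$. The trace is $\operatorname{tr}(\mathcal{A})=\operatorname{tr}(\operatorname{bcirc}(\mathcal{A}))$, and the Riemannian metric $g$ is $g_{\mathcal{P}}(\mathcal{X},\mathcal{Y})=\operatorname{tr}(\mathcal{P}^{-1}*\mathcal{X}*\mathcal{P}^{-1}*\mathcal{Y})$. For $\mathcal{A}\in\mathbb{H}^{n\times n\times p}_{++}$ and $r\in\mathbb{R}$, $\mathcal{A}^r\in\mathbb{H}^{n\times n\times p}_{++}$ is the real power, characterized by $\operatorname{bcirc}(\mathcal{A}^r)=\operatorname{bcirc}(\mathcal{A})^r$ (usual real power of a Hermitian positive definite matrix). *)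

theory Defs
  imports "HOL-Analysis.Analysis"
begin

section \<open>Third-order tensors and the T-product\<close>

text \<open>
  A tensor of size \<open>m \<times> n \<times> p\<close> is an element of \<open>complex^'n^'m^'p\<close>: the entry in row \<open>i\<close> and
  column \<open>j\<close> of the frontal slice \<open>k\<close> is \<open>A $ k $ i $ j\<close>.  The sizes are the cardinalities of the
  index types.  The linear order on \<open>'p\<close> serves only to number the slices: the slices
  \<open>A\<^sup>(\<^sup>1\<^sup>), \<dots>, A\<^sup>(\<^sup>p\<^sup>)\<close> are those at positions \<open>0, \<dots>, p - 1\<close>.
\<close>

definition pos :: "'p::{finite,linorder} \<Rightarrow> int" where
  "pos k = int (card {l. l < k})"

text \<open>The index whose position is \<open>i\<close> modulo \<open>p\<close>.\<close>

definition idx :: "int \<Rightarrow> 'p::{finite,linorder}" where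
  "idx i = (THE k. pos k = i mod int CARD('p))"

definition bcirc :: "complex^'n^'m^'p::{finite,linorder} \<Rightarrow> complex^('p \<times> 'n)^('p \<times> 'm)" where
  "bcirc A = (\<chi> r c. A $ idx (pos (fst r) - pos (fst c)) $ snd r $ snd c)"

definition unfold_tensor :: "complex^'n^'m^'p \<Rightarrow> complex^'n^('p \<times> 'm)" where
  "unfold_tensor A = (\<chi> r j. A $ fst r $ snd r $ j)"

definition fold_tensor :: "complex^'n^('p \<times> 'm) \<Rightarrow> complex^'n^'m^'p" where
  "fold_tensor M = (\<chi> k i j. M $ (k, i) $ j)"

definition tprod ::
    "complex^'n^'m^'p::{finite,linorder} \<Rightarrow> complex^'q^'n^'p::{finite,linorder} \<Rightarrow>
     complex^'q^'m^'p::{finite,linorder}"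
    (infixl "\<star>" 70) where
  "A \<star> B = fold_tensor (bcirc A ** unfold_tensor B)"

definition tident :: "complex^'n^'n^'p::{finite,linorder}" where
  "tident = (\<chi> k. if k = idx 0 then mat 1 else 0)"

definition tinv ::
    "complex^'n^'n^'p::{finite,linorder} \<Rightarrow> complex^'n^'n^'p::{finite,linorder}" where
  "tinv A = (THE B. A \<star> B = tident \<and> B \<star> A = tident)"

definition conj_transpose :: "complex^'n^'m \<Rightarrow> complex^'m^'n" where
  "conj_transpose M = (\<chi> i j. cnj (M $ j $ i))"

definition tconj_transpose ::
    "complex^'n^'m^'p::{finite,linorder} \<Rightarrow> complex^'m^'n^'p::{finite,linorder}" where
  "tconj_transpose A = (\<chi> k. conj_transpose (A $ idx (- pos k)))"

definition tinner :: "complex^'n^'m^'p \<Rightarrow> complex^'n^'m^'p \<Rightarrow> complex" where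
  "tinner A B = (\<Sum>k\<in>UNIV. \<Sum>i\<in>UNIV. \<Sum>j\<in>UNIV. cnj (A $ k $ i $ j) * B $ k $ i $ j)"

definition ttrace :: "complex^'n^'n^'p::{finite,linorder} \<Rightarrow> complex" where
  "ttrace A = trace (bcirc A)"

definition THerm :: "(complex^'n^'n^'p::{finite,linorder}) set" where
  "THerm = {A. tconj_transpose A = A}"

definition TPD :: "(complex^'n^'n^'p::{finite,linorder}) set" where
  "TPD = {A \<in> THerm. \<forall>X :: complex^1^'n^'p::{finite,linorder}. X \<noteq> 0 \<longrightarrow>
            tinner X (A \<star> X) \<in> \<real> \<and> Re (tinner X (A \<star> X)) > 0}"

section \<open>Real powers\<close>

definition unitary_matrix :: "complex^'n^'n \<Rightarrow> bool" where
  "unitary_matrix U \<longleftrightarrow> conj_transpose U ** U = mat 1 \<and> U ** conj_transpose U = mat 1"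

definition real_diag :: "('n \<Rightarrow> real) \<Rightarrow> complex^'n^'n" where
  "real_diag d = (\<chi> i j. if i = j then complex_of_real (d i) else 0)"

text \<open>
  The real power of a Hermitian positive definite matrix.  The result does not depend on the
  choice of the spectral decomposition, hence the definite description.
\<close>

definition matrix_powr :: "complex^'n^'n \<Rightarrow> real \<Rightarrow> complex^'n^'n" where
  "matrix_powr M r = (THE N. \<exists>U d. unitary_matrix U \<and> (\<forall>i. d i > 0) \<and>
      M = U ** real_diag d ** conj_transpose U \<and>
      N = U ** real_diag (\<lambda>i. d i powr r) ** conj_transpose U)"

definition tpowr ::
    "complex^'n^'n^'p::{finite,linorder} \<Rightarrow> real \<Rightarrow> complex^'n^'n^'p::{finite,linorder}" where
  "tpowr A r = (THE B. bcirc B = matrix_powr (bcirc A) r)"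

section \<open>Geodesics\<close>

text \<open>
  Below, \<open>U\<close> is a relatively open subset of a linear subspace \<open>V\<close>, regarded as a manifold with
  tangent space \<open>V\<close> at each point, and \<open>g P X Y\<close> is a Riemannian metric on it.  Since \<open>V\<close> provides a
  global chart, the Levi-Civita connection is given by the Christoffel symbols of \<open>g\<close>.
\<close>

definition metric_deriv ::
    "('a::real_normed_vector \<Rightarrow> 'a \<Rightarrow> 'a \<Rightarrow> real) \<Rightarrow> 'a \<Rightarrow> 'a \<Rightarrow> 'a \<Rightarrow> 'a \<Rightarrow> real" where
  "metric_deriv g P W X Y = deriv (\<lambda>s. g (P + s *\<^sub>R W) X Y) 0"

text \<open>The Christoffel symbols of the first kind, from the Koszul formula for constant fields.\<close>

definition christoffel ::
    "('a::real_normed_vector \<Rightarrow> 'a \<Rightarrow> 'a \<Rightarrow> real) \<Rightarrow> 'a \<Rightarrow> 'a \<Rightarrow> 'a \<Rightarrow> 'a \<Rightarrow> real" where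
  "christoffel g P X Y Z =
     (metric_deriv g P X Y Z + metric_deriv g P Y X Z - metric_deriv g P Z X Y) / 2"

text \<open>
  \<open>D\<close> is the covariant derivative of the velocity along a curve that passes through \<open>P\<close> with
  velocity \<open>v\<close> and coordinate acceleration \<open>a\<close>, that is, \<open>D = a + \<Gamma>\<^sub>P(v, v)\<close>.
\<close>

definition is_cov_accel ::
    "('a::real_normed_vector \<Rightarrow> 'a \<Rightarrow> 'a \<Rightarrow> real) \<Rightarrow> 'a set \<Rightarrow> 'a \<Rightarrow> 'a \<Rightarrow> 'a \<Rightarrow> 'a \<Rightarrow> bool" where
  "is_cov_accel g V P v a D \<longleftrightarrow>
     D \<in> V \<and> (\<forall>Z\<in>V. g P D Z = g P a Z + christoffel g P v v Z)"

definition C2_curve_in ::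
    "'a::real_normed_vector set \<Rightarrow> (real \<Rightarrow> 'a) \<Rightarrow> (real \<Rightarrow> 'a) \<Rightarrow> (real \<Rightarrow> 'a) \<Rightarrow> bool" where
  "C2_curve_in U c c' c'' \<longleftrightarrow>
     (\<forall>t\<in>{0..1}. c t \<in> U \<and>
        (c has_vector_derivative c' t) (at t within {0..1}) \<and>
        (c' has_vector_derivative c'' t) (at t within {0..1})) \<and>
     continuous_on {0..1} c''"

definition geodesic ::
    "('a::real_normed_vector \<Rightarrow> 'a \<Rightarrow> 'a \<Rightarrow> real) \<Rightarrow> 'a set \<Rightarrow> 'a set \<Rightarrow> (real \<Rightarrow> 'a) \<Rightarrow> bool" where
  "geodesic g V U c \<longleftrightarrow>
     (\<exists>c' c''. C2_curve_in U c c' c'' \<and>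
        (\<forall>t\<in>{0..1}. is_cov_accel g V (c t) (c' t) (c'' t) 0))"

text \<open>
  A geodesic with arbitrary parametrization: a constant curve, or a regular curve whose covariant
  acceleration is everywhere a multiple of its velocity.
\<close>

definition unparametrized_geodesic ::
    "('a::real_normed_vector \<Rightarrow> 'a \<Rightarrow> 'a \<Rightarrow> real) \<Rightarrow> 'a set \<Rightarrow> 'a set \<Rightarrow> (real \<Rightarrow> 'a) \<Rightarrow> bool" where
  "unparametrized_geodesic g V U c \<longleftrightarrow>
     (\<exists>c' c''. C2_curve_in U c c' c'' \<and>
        ((\<forall>t\<in>{0..1}. c' t = 0) \<or>
         (\<forall>t\<in>{0..1}. c' t \<noteq> 0 \<and> (\<exists>f. is_cov_accel g V (c t) (c' t) (c'' t) (f *\<^sub>R c' t)))))"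

definition reparametrization_of :: "(real \<Rightarrow> 'a) \<Rightarrow> (real \<Rightarrow> 'a) \<Rightarrow> bool" where
  "reparametrization_of c \<gamma> \<longleftrightarrow>
     (\<exists>\<phi> \<phi>'. \<phi> 0 = 0 \<and> \<phi> 1 = 1 \<and> continuous_on {0..1} \<phi>' \<and>
        (\<forall>t\<in>{0..1}. (\<phi> has_real_derivative \<phi>' t) (at t within {0..1}) \<and> \<phi>' t > 0 \<and>
                    c t = \<gamma> (\<phi> t)))"

text \<open>
  The Riemannian metric on \<open>TPD\<close>.  For \<open>P \<in> TPD\<close> and \<open>X, Y \<in> THerm\<close> the trace is real; taking the
  real part only adjusts the type.
\<close>

definition tmetric ::
    "complex^'n^'n^'p::{finite,linorder} \<Rightarrow> complex^'n^'n^'p::{finite,linorder} \<Rightarrow>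
     complex^'n^'n^'p::{finite,linorder} \<Rightarrow> real" where
  "tmetric P X Y = Re (ttrace (tinv P \<star> X \<star> tinv P \<star> Y))"

end

theory Submission
  imports Defs
begin

text \<open>
  The map \<^const>\<open>bcirc\<close> embeds the tensors with the T-product as the algebra of block circulant
  matrices and turns T-conjugation into conjugate transposition.  A matrix is block circulant
  exactly if it commutes with all block shifts (\<open>block_shift_commute\<close>,
  \<open>commuting_block_shift_imp_bcirc\<close>).  Inverses and real powers of a matrix commute with whatever the
  matrix commutes with, so they stay in this algebra (\<open>bcirc_tinv\<close>, \<open>bcirc_tpowr\<close>), and the
  geometry can be studied for Hermitian positive definite matrices.

  Differentiating \<open>P\<^sup>-\<^sup>1\<close> in the metric shows that a curve \<open>c\<close> has covariant acceleration
  \<open>c'' - c' c\<^sup>-\<^sup>1 c'\<close> (\<open>is_cov_accel_tmetric_iff\<close>).  If this equals \<open>f c'\<close>, then \<open>c\<^sup>-\<^sup>1 c'\<close> is constant up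
  to the factor \<open>exp (\<integral>f)\<close> (\<open>pregeodesic_first_integral\<close>).  Hence \<open>c' = \<phi>' c K\<close> with a fixed matrix \<open>K\<close>
  and an increasing function \<open>\<phi>\<close>; for a geodesic, \<open>f = 0\<close> and \<open>\<phi> t = t\<close>.

  Write \<open>A = c 0\<close> and \<open>B = c 1\<close>.  Conjugation with \<open>A\<^sup>1\<^sup>/\<^sup>2\<close> makes \<open>K\<close> Hermitian, and in an eigenbasis of
  the result, with eigenvalues \<open>h\<^sub>j\<close>, the equation \<open>c' = \<phi>' c K\<close> decouples into the scalar equations
  \<open>y' = \<phi>' h\<^sub>j y\<close>.  So \<open>A\<^sup>-\<^sup>1\<^sup>/\<^sup>2 c A\<^sup>-\<^sup>1\<^sup>/\<^sup>2\<close> is diagonal in this basis with entries \<open>exp (h\<^sub>j \<phi>)\<close>.  Where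
  \<open>\<phi> = 1\<close> this is the matrix \<open>A\<^sup>-\<^sup>1\<^sup>/\<^sup>2 B A\<^sup>-\<^sup>1\<^sup>/\<^sup>2\<close>, so in general it is its \<open>\<phi>\<close>-th power
  (\<open>exponential_curve_eq_geometric_mean\<close>).  This gives uniqueness; conversely the velocity of the
  asserted curve has the form \<open>\<gamma> K\<close> with \<open>K\<close> constant, so it solves the geodesic equation.
\<close>

section \<open>Hermitian matrices and the spectral theorem\<close>

definition cdot :: "complex^'n \<Rightarrow> complex^'n \<Rightarrow> complex" where
  "cdot x y = (\<Sum>i\<in>UNIV. cnj (x $ i) * y $ i)"

lemma inner_eq_Re_cdot: "x \<bullet> y = Re (cdot x y)" for x y :: "complex^'n"
  by (simp add: inner_vec_def cdot_def inner_complex_def)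

lemma cdot_add_right: "cdot x (y + z) = cdot x y + cdot x z"
  by (simp add: cdot_def algebra_simps sum.distrib)

lemma cdot_diff_right: "cdot x (y - z) = cdot x y - cdot x z"
  by (simp add: cdot_def algebra_simps sum_subtractf)

lemma cdot_scaleR_right: "cdot x (r *\<^sub>R y) = r *\<^sub>R cdot x y"
  by (simp add: cdot_def scaleR_sum_right)

lemma cdot_scaleR_left: "cdot (r *\<^sub>R x) y = r *\<^sub>R cdot x y"
  by (simp add: cdot_def scaleR_sum_right)

lemma cnj_cdot: "cnj (cdot x y) = cdot y x"
  by (simp add: cdot_def mult.commute)

lemma cdot_self: "cdot x x = complex_of_real (x \<bullet> x)"
  by (metis Reals_cnj_iff cnj_cdot inner_eq_Re_cdot of_real_Re)

lemma cdot_matrix_left: "cdot x (M *v y) = cdot (conj_transpose M *v x) y"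
proof -
  have "cdot x (M *v y) = (\<Sum>i\<in>UNIV. \<Sum>j\<in>UNIV. cnj (x $ i) * M $ i $ j * y $ j)"
    by (simp add: cdot_def matrix_vector_mult_def sum_distrib_left mult.assoc)
  also have "\<dots> = (\<Sum>j\<in>UNIV. \<Sum>i\<in>UNIV. cnj (x $ i) * M $ i $ j * y $ j)"
    by (rule sum.swap)
  also have "\<dots> = cdot (conj_transpose M *v x) y"
    by (simp add: cdot_def matrix_vector_mult_def conj_transpose_def sum_distrib_left
        sum_distrib_right mult_ac)
  finally show ?thesis .
qed

lemma conj_transpose_mult: "conj_transpose (A ** B) = conj_transpose B ** conj_transpose A"
  by (simp add: conj_transpose_def matrix_matrix_mult_def vec_eq_iff mult.commute)

lemma conj_transpose_involution [simp]: "conj_transpose (conj_transpose A) = A"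
  by (simp add: conj_transpose_def vec_eq_iff)

lemma conj_transpose_mat_1 [simp]: "conj_transpose (mat 1) = mat 1"
  by (simp add: conj_transpose_def vec_eq_iff mat_def)

lemma conj_transpose_real_diag [simp]: "conj_transpose (real_diag d) = real_diag d"
  by (simp add: conj_transpose_def vec_eq_iff real_diag_def)

lemma scaleR_matrix_mult_left: "(r *\<^sub>R A) ** B = r *\<^sub>R (A ** B)"
  for A :: "complex^'n^'m" and B :: "complex^'k^'n"
  by (simp add: matrix_matrix_mult_def vec_eq_iff scaleR_sum_right)

lemma scaleR_matrix_mult_right: "A ** (r *\<^sub>R B) = r *\<^sub>R (A ** B)"
  for A :: "complex^'n^'m" and B :: "complex^'k^'n"
  by (simp add: matrix_matrix_mult_def vec_eq_iff scaleR_sum_right)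

lemma matrix_add_rdistrib: "(A + B) ** C = A ** C + B ** C"
  for A :: "complex^'n^'m" and C :: "complex^'k^'n"
  by (simp add: matrix_matrix_mult_def vec_eq_iff algebra_simps sum.distrib)

lemma scaleR_matrix_vector_mult_right: "A *v (r *\<^sub>R x) = r *\<^sub>R (A *v x)"
  for A :: "complex^'n^'m"
  by (simp add: matrix_vector_mult_def vec_eq_iff scaleR_sum_right)

lemma cdot_eigenvector_image:
  assumes "conj_transpose M = M" "M *v u = d *\<^sub>R u" "cdot u x = 0"
  shows "cdot u (M *v x) = 0"
  using assms by (simp add: cdot_matrix_left cdot_scaleR_left)

text \<open>
  The vectors orthogonal to the given eigenvectors form an \<open>M\<close>-invariant subspace \<open>W\<close>, and the
  Rayleigh quotient has a maximum \<open>l\<close> on its unit sphere.  The form \<open>q\<close> below is nonnegative on \<open>W\<close> and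
  vanishes at the maximizer \<open>x\<close>.  Its first variation at \<open>x\<close> in the direction of the residual
  \<open>z = M x - l x\<close>, which lies in \<open>W\<close>, must vanish, and it is \<open>-2 (z \<bullet> z)\<close>.
\<close>

lemma exists_eigenvector_orthogonal:
  fixes M :: "complex^'n^'n" and u :: "'i \<Rightarrow> complex^'n"
  assumes herm: "conj_transpose M = M"
    and eig: "\<And>i. i \<in> I \<Longrightarrow> M *v u i = d i *\<^sub>R u i"
    and ne: "\<exists>x. x \<noteq> 0 \<and> (\<forall>i\<in>I. cdot (u i) x = 0)"
  shows "\<exists>x l. norm x = 1 \<and> (\<forall>i\<in>I. cdot (u i) x = 0) \<and> M *v x = (l::real) *\<^sub>R x"
proof -
  define W where "W = {x. \<forall>i\<in>I. cdot (u i) x = 0}"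
  define K where "K = sphere 0 1 \<inter> W"
  have MW: "M *v x \<in> W" if "x \<in> W" for x
    using that cdot_eigenvector_image[OF herm eig] by (auto simp: W_def)
  have W_lin: "x + r *\<^sub>R y \<in> W" "r *\<^sub>R x \<in> W" "x - r *\<^sub>R y \<in> W" if "x \<in> W" "y \<in> W" for x y r
    using that by (auto simp: W_def cdot_add_right cdot_diff_right cdot_scaleR_right)
  have "closed W"
  proof -
    have "W = (\<Inter>i\<in>I. {x. cdot (u i) x = 0})" by (auto simp: W_def)
    moreover have "closed {x. cdot (u i) x = 0}" for i
      unfolding cdot_def by (intro closed_Collect_eq continuous_intros)
    ultimately show ?thesis by auto
  qed
  hence "compact K" unfolding K_def by (intro compact_Int_closed) auto
  moreover have "K \<noteq> {}"
  proof -
    obtain x where x: "x \<noteq> 0" "x \<in> W" using ne by (auto simp: W_def)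
    hence "(1 / norm x) *\<^sub>R x \<in> K" using W_lin(2)[of x x] by (simp add: K_def)
    thus ?thesis by blast
  qed
  moreover have "continuous_on K (\<lambda>x. x \<bullet> (M *v x))"
    unfolding matrix_vector_mult_def by (intro continuous_intros)
  ultimately obtain x where x: "x \<in> K" and max: "\<And>y. y \<in> K \<Longrightarrow> y \<bullet> (M *v y) \<le> x \<bullet> (M *v x)"
    using continuous_attains_sup by metis
  define l where "l = x \<bullet> (M *v x)"
  define q where "q y = l * (y \<bullet> y) - y \<bullet> (M *v y)" for y
  have sym: "y \<bullet> (M *v z) = z \<bullet> (M *v y)" for y z
    by (metis cdot_matrix_left herm inner_commute inner_eq_Re_cdot)
  have q_nonneg: "q y \<ge> 0" if "y \<in> W" for y
  proof (cases "y = 0")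
    case False
    define z where "z = (1 / norm y) *\<^sub>R y"
    have "z \<in> K" using False that W_lin(2)[of y y] by (simp add: K_def z_def)
    hence "z \<bullet> (M *v z) \<le> l" using max by (simp add: l_def)
    moreover have "y = norm y *\<^sub>R z" using False by (simp add: z_def)
    hence "y \<bullet> (M *v y) = (norm y)\<^sup>2 * (z \<bullet> (M *v z))"
      by (metis (no_types, opaque_lifting) inner_scaleR_left inner_scaleR_right mult.assoc
          power2_eq_square scaleR_matrix_vector_mult_right)
    ultimately show ?thesis
      by (simp add: q_def power2_norm_eq_inner[symmetric] mult.commute[of l] mult_left_mono)
  qed (simp add: q_def)
  have xx: "x \<bullet> x = 1" "x \<in> W" using x by (simp_all add: K_def dot_square_norm)
  define z where "z = M *v x - l *\<^sub>R x"
  define a where "a = - 2 * (z \<bullet> z)"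
  have zW: "z \<in> W" unfolding z_def using W_lin(3)[OF MW] xx by blast
  have expand: "q (x + t *\<^sub>R z) = a * t + q z * t\<^sup>2" for t
  proof -
    have "z \<bullet> (M *v x) - l * (x \<bullet> z) = z \<bullet> z"
      by (simp add: z_def inner_diff_right inner_diff_left inner_commute algebra_simps)
    moreover have "x \<bullet> (M *v z) = z \<bullet> (M *v x)" by (rule sym)
    moreover have "z \<bullet> x = x \<bullet> z" by (rule inner_commute)
    ultimately have "q (x + t *\<^sub>R z) = l * (x \<bullet> x) - x \<bullet> (M *v x) + a * t + q z * t\<^sup>2"
      unfolding q_def a_def
      by (simp add: matrix_vector_right_distrib scaleR_matrix_vector_mult_right inner_add_left
          inner_add_right algebra_simps power2_eq_square)
    thus ?thesis using xx by (simp add: l_def)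
  qed
  \<comment> \<open>A quadratic polynomial without constant term that is nonnegative has no linear term.\<close>
  have "a = 0"
  proof -
    define t where "t = - a / (q z + 1)"
    have qz: "q z + 1 > 0" using q_nonneg[OF zW] by simp
    have "0 \<le> a * t + q z * t\<^sup>2"
      using q_nonneg[OF W_lin(1)[OF xx(2) zW]] expand by simp
    also have "\<dots> = - (a\<^sup>2 / (q z + 1)\<^sup>2)"
      using qz unfolding t_def by (simp add: divide_simps power2_eq_square) algebra
    finally have "a\<^sup>2 / (q z + 1)\<^sup>2 \<le> 0" by simp
    thus ?thesis using qz by (simp add: divide_le_0_iff)
  qed
  hence "M *v x = l *\<^sub>R x" by (simp add: a_def z_def)
  thus ?thesis using x by (auto simp: K_def W_def)
qed

text \<open>
  The matrix with rows \<open>cnj (u i)\<close> for \<open>i \<in> I\<close> has a zero row \<open>j\<close>, so it is singular; the required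
  vector is in its kernel.
\<close>

lemma exists_orthogonal_vector:
  fixes u :: "'n \<Rightarrow> complex^'n"
  assumes "j \<notin> I"
  shows "\<exists>x. x \<noteq> 0 \<and> (\<forall>i\<in>I. cdot (u i) x = 0)"
proof -
  define N :: "complex^'n^'n" where "N = (\<chi> i k. if i \<in> I then cnj (u i $ k) else 0)"
  have row: "(N *v x) $ i = (if i \<in> I then cdot (u i) x else 0)" for x i
    by (simp add: N_def matrix_vector_mult_def cdot_def)
  have "\<nexists>B. N ** B = mat 1"
  proof
    assume "\<exists>B. N ** B = mat 1"
    then obtain B where B: "N ** B = mat 1" by blast
    have "(N ** B) $ j $ j = 0" using assms by (simp add: matrix_matrix_mult_def N_def)
    thus False using B by (simp add: mat_def)
  qed
  hence "\<nexists>B. B ** N = mat 1" using matrix_left_right_inverse by blast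
  then obtain x where "x \<noteq> 0" "N *v x = 0" using matrix_left_invertible_ker by blast
  thus ?thesis using row by (metis zero_index)
qed

text \<open>
  Indexing the vectors by a subset \<open>I\<close> of the matrix index type makes the case \<open>I = UNIV\<close> deliver the
  columns of a unitary matrix.
\<close>

lemma orthonormal_eigenvectors:
  fixes M :: "complex^'n^'n" and I :: "'n set"
  assumes herm: "conj_transpose M = M"
  shows "\<exists>u d. (\<forall>i\<in>I. \<forall>j\<in>I. cdot (u i) (u j) = (if i = j then 1 else 0)) \<and>
               (\<forall>i\<in>I. M *v u i = d i *\<^sub>R u i)" (is "\<exists>u d. ?P I u d")
using finite[of I]
proof (induction I rule: finite_induct)
  case (insert j I)
  then obtain u :: "'n \<Rightarrow> complex^'n" and d where ud: "?P I u d" by blast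
  obtain x l where x: "norm x = 1" "\<forall>i\<in>I. cdot (u i) x = 0" "M *v x = (l::real) *\<^sub>R x"
    using exists_eigenvector_orthogonal[OF herm, of I u d] ud exists_orthogonal_vector[OF insert(2)]
    by metis
  have "cdot x (u i) = 0" if "i \<in> I" for i using x(2) that cnj_cdot[of "u i" x] by simp
  moreover have "cdot x x = 1" using x(1) by (simp add: cdot_self dot_square_norm)
  ultimately have "?P (insert j I) (u(j := x)) (d(j := l))"
    using ud x insert(2) by (auto simp: fun_upd_def)
  thus ?case by blast
qed simp

definition spectral :: "complex^'n^'n \<Rightarrow> ('n \<Rightarrow> real) \<Rightarrow> complex^'n^'n" where
  "spectral U d = U ** real_diag d ** conj_transpose U"

lemma unitary_matrixI: "conj_transpose U ** U = mat 1 \<Longrightarrow> unitary_matrix U"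
  using matrix_left_right_inverse unitary_matrix_def by blast

lemma matrix_mult_real_diag: "(W ** real_diag d) $ i $ j = W $ i $ j * complex_of_real (d j)"
  by (simp add: matrix_matrix_mult_def real_diag_def if_distrib[of "\<lambda>x. _ * x"] cong: if_cong)

lemma real_diag_matrix_mult: "(real_diag d ** W) $ i $ j = complex_of_real (d i) * W $ i $ j"
  by (simp add: matrix_matrix_mult_def real_diag_def if_distrib[of "\<lambda>x. x * _"] cong: if_cong)

theorem spectral_theorem:
  fixes M :: "complex^'n^'n"
  assumes herm: "conj_transpose M = M"
  obtains U d where "unitary_matrix U" "M = spectral U d"
proof -
  obtain u :: "'n \<Rightarrow> complex^'n" and d where u: "\<And>i j. cdot (u i) (u j) = (if i = j then 1 else 0)"
    and eig: "\<And>i. M *v u i = d i *\<^sub>R u i"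
    using orthonormal_eigenvectors[OF herm, of UNIV] unfolding ball_UNIV by blast
  define U :: "complex^'n^'n" where "U = (\<chi> i j. u j $ i)"
  have "conj_transpose U ** U = mat 1"
    using u by (simp add: vec_eq_iff conj_transpose_def U_def matrix_matrix_mult_def cdot_def mat_def)
  hence U: "unitary_matrix U" by (rule unitary_matrixI)
  have "M ** U = U ** real_diag d"
  proof -
    have "(M ** U) $ i $ j = (M *v u j) $ i" for i j
      by (simp add: matrix_matrix_mult_def matrix_vector_mult_def U_def)
    moreover have "(U ** real_diag d) $ i $ j = (d j *\<^sub>R u j) $ i" for i j
      by (simp add: matrix_mult_real_diag U_def) (simp add: scaleR_conv_of_real mult.commute)
    ultimately show ?thesis using eig by (simp add: vec_eq_iff)
  qed
  hence "M = spectral U d"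
    using U unfolding spectral_def unitary_matrix_def
    by (metis matrix_mul_assoc matrix_mul_rid)
  with U show ?thesis by (rule that)
qed

section \<open>Positive definite matrices and their powers\<close>

lemma unitary_left_cancel:
  "unitary_matrix U \<Longrightarrow> conj_transpose U ** (U ** X) = X"
  "unitary_matrix U \<Longrightarrow> U ** (conj_transpose U ** X) = X"
  by (simp_all add: matrix_mul_assoc unitary_matrix_def)

lemma real_diag_1: "real_diag (\<lambda>_. 1) = mat 1"
  by (simp add: real_diag_def mat_def vec_eq_iff)

lemma spectral_1: "unitary_matrix U \<Longrightarrow> spectral U (\<lambda>_. 1) = mat 1"
  by (simp add: spectral_def real_diag_1 unitary_matrix_def)

lemma spectral_mult:
  fixes U :: "complex^'n^'n"
  assumes "unitary_matrix U"
  shows "spectral U d ** spectral U e = spectral U (\<lambda>i. d i * e i)"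
proof -
  have "real_diag d ** real_diag e = real_diag (\<lambda>i. d i * e i)"
    by (simp add: vec_eq_iff matrix_mult_real_diag) (simp add: real_diag_def)
  hence "real_diag d ** (real_diag e ** X) = real_diag (\<lambda>i. d i * e i) ** X"
    for X :: "complex^'n^'n"
    by (simp add: matrix_mul_assoc)
  thus ?thesis
    using assms by (simp add: spectral_def matrix_mul_assoc[symmetric] unitary_left_cancel)
qed

text \<open>
  In the two eigenbases \<open>S\<close> becomes a matrix \<open>W\<close> with \<open>W\<^sub>i\<^sub>j d\<^sub>j = e\<^sub>i W\<^sub>i\<^sub>j\<close>.  So \<open>W\<^sub>i\<^sub>j\<close> vanishes unless
  \<open>d\<^sub>j = e\<^sub>i\<close>, and \<open>f\<close> may be applied to the eigenvalues.  For \<open>S = 1\<close> this says that functions of a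
  Hermitian matrix are independent of the spectral decomposition; for equal decompositions it says
  that they commute with whatever the matrix commutes with.
\<close>

lemma spectral_intertwine:
  fixes U V S :: "complex^'n^'n"
  assumes U: "unitary_matrix U" and V: "unitary_matrix V"
    and eq: "S ** spectral U d = spectral V e ** S"
  shows "S ** spectral U (\<lambda>i. f (d i)) = spectral V (\<lambda>i. f (e i)) ** S"
proof -
  define W where "W = conj_transpose V ** S ** U"
  have S: "S = V ** W ** conj_transpose U"
    using U V by (simp add: W_def matrix_mul_assoc[symmetric] unitary_left_cancel)
      (simp add: unitary_matrix_def)
  have "conj_transpose V ** (S ** spectral U d) ** U = W ** real_diag d"
    using U by (simp add: W_def spectral_def matrix_mul_assoc[symmetric] unitary_left_cancel)
      (simp add: unitary_matrix_def)
  moreover have "conj_transpose V ** (spectral V e ** S) ** U = real_diag e ** W"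
    using V by (simp add: W_def spectral_def matrix_mul_assoc[symmetric] unitary_left_cancel)
  ultimately have "W ** real_diag d = real_diag e ** W" using eq by simp
  hence comm: "W $ i $ j * complex_of_real (d j) = complex_of_real (e i) * W $ i $ j" for i j
    by (metis matrix_mult_real_diag real_diag_matrix_mult)
  have "W $ i $ j = 0 \<or> d j = e i" for i j
    using comm[of i j] by (auto simp: mult.commute[of "W $ i $ j"])
  hence "W $ i $ j * complex_of_real (f (d j)) = complex_of_real (f (e i)) * W $ i $ j" for i j
    by (metis mult.commute mult_zero_left)
  hence "W ** real_diag (\<lambda>i. f (d i)) = real_diag (\<lambda>i. f (e i)) ** W"
    by (simp add: vec_eq_iff matrix_mult_real_diag real_diag_matrix_mult)
  hence "V ** (W ** real_diag (\<lambda>i. f (d i))) ** conj_transpose U =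
         V ** (real_diag (\<lambda>i. f (e i)) ** W) ** conj_transpose U" by simp
  thus ?thesis
    using U V by (simp add: S spectral_def matrix_mul_assoc[symmetric] unitary_left_cancel)
qed

lemma matrix_powr_spectral:
  fixes U :: "complex^'n^'n"
  assumes U: "unitary_matrix U" and d: "\<And>i. d i > 0"
  shows "matrix_powr (spectral U d) r = spectral U (\<lambda>i. d i powr r)"
  unfolding matrix_powr_def spectral_def[symmetric]
proof (rule the_equality)
  show "\<exists>V e. unitary_matrix V \<and> (\<forall>i. 0 < e i) \<and> spectral U d = spectral V e \<and>
          spectral U (\<lambda>i. d i powr r) = spectral V (\<lambda>i. e i powr r)"
    using assms by blast
next
  fix N assume "\<exists>V e. unitary_matrix V \<and> (\<forall>i. 0 < e i) \<and> spectral U d = spectral V e \<and>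
      N = spectral V (\<lambda>i. e i powr r)"
  then obtain V e where V: "unitary_matrix V" and eq: "spectral U d = spectral V e"
    and N: "N = spectral V (\<lambda>i. e i powr r)" by blast
  have "mat 1 ** spectral U d = spectral V e ** mat 1" using eq by simp
  from spectral_intertwine[OF U V this, of "\<lambda>x. x powr r"] N
  show "N = spectral U (\<lambda>i. d i powr r)" by simp
qed

text \<open>
  For Hermitian \<open>M\<close> the number \<open>x\<^sup>* M x\<close> is real, hence equal to the inner product of \<open>x\<close> and \<open>M x\<close> as
  vectors of a real Euclidean space.
\<close>

definition posdef :: "complex^'n^'n \<Rightarrow> bool" where
  "posdef M \<longleftrightarrow> conj_transpose M = M \<and> (\<forall>x. x \<noteq> 0 \<longrightarrow> x \<bullet> (M *v x) > 0)"

lemma inner_matrix_left: "x \<bullet> (M *v y) = (conj_transpose M *v x) \<bullet> y" for x :: "complex^'n"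
  by (simp add: inner_eq_Re_cdot cdot_matrix_left)

lemma posdef_congruence:
  fixes M S :: "complex^'n^'n"
  assumes M: "posdef M" and S: "T ** S = mat 1"
  shows "posdef (conj_transpose S ** M ** S)"
  unfolding posdef_def
proof (intro conjI allI impI)
  show "conj_transpose (conj_transpose S ** M ** S) = conj_transpose S ** M ** S"
    using M by (simp add: posdef_def conj_transpose_mult matrix_mul_assoc)
next
  fix x :: "complex^'n" assume x: "x \<noteq> 0"
  have "S *v x \<noteq> 0"
    using S x by (metis matrix_vector_mul_assoc matrix_vector_mul_lid matrix_vector_mult_0_right)
  hence "(S *v x) \<bullet> (M *v (S *v x)) > 0" using M by (simp add: posdef_def)
  thus "x \<bullet> ((conj_transpose S ** M ** S) *v x) > 0"
    by (simp add: matrix_vector_mul_assoc[symmetric] inner_matrix_left[of x "conj_transpose S"])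
qed

lemma inner_real_diag:
  "x \<bullet> (real_diag d *v x) = (\<Sum>i\<in>UNIV. d i * (x $ i \<bullet> x $ i))"
  for x :: "complex^'n" and d :: "'n \<Rightarrow> real"
proof -
  have "(real_diag d *v x) $ i = d i *\<^sub>R x $ i" for i
    by (simp add: matrix_vector_mult_def real_diag_def if_distrib[of "\<lambda>x. x * _"]
        scaleR_conv_of_real cong: if_cong)
  thus ?thesis by (simp add: inner_vec_def)
qed

lemma posdef_real_diag_iff: "posdef (real_diag d) \<longleftrightarrow> (\<forall>i. d i > 0)"
  for d :: "'n::finite \<Rightarrow> real"
proof
  assume pd: "posdef (real_diag d)"
  show "\<forall>i. d i > 0"
  proof
    fix i
    have "0 < axis i 1 \<bullet> (real_diag d *v axis i 1)" using pd by (simp add: posdef_def)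
    also have "\<dots> = d i"
      by (simp add: inner_real_diag axis_def if_distrib[of "\<lambda>z. z \<bullet> _"] if_distrib[of "\<lambda>z. _ * z"]
          cong: if_cong)
    finally show "d i > 0" .
  qed
next
  assume d: "\<forall>i. d i > 0"
  have "x \<bullet> (real_diag d *v x) > 0" if "x \<noteq> 0" for x :: "complex^'n"
  proof -
    have "\<exists>i. x $ i \<noteq> 0" using that by (simp add: vec_eq_iff)
    then obtain i where "x $ i \<noteq> 0" ..
    hence "d i * (x $ i \<bullet> x $ i) > 0" using d by simp
    thus ?thesis unfolding inner_real_diag
      using d by (intro sum_pos2[of UNIV i]) (auto simp: less_imp_le)
  qed
  thus "posdef (real_diag d)" by (simp add: posdef_def)
qed

lemma posdef_spectral:
  assumes "unitary_matrix U" "\<And>i. d i > 0"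
  shows "posdef (spectral U d)"
  using posdef_congruence[of "real_diag d" U "conj_transpose U"] assms
  by (simp add: posdef_real_diag_iff spectral_def unitary_matrix_def)

text \<open>
  The spectral theorem gives real eigenvalues; congruence with \<open>U\<close> carries positivity of \<open>M\<close> over to
  the diagonal matrix of these eigenvalues.
\<close>

lemma posdef_obtain_spectral:
  assumes M: "posdef M"
  obtains U d where "unitary_matrix U" "\<And>i. d i > 0" "M = spectral U d"
proof -
  obtain U d where U: "unitary_matrix U" and Md: "M = spectral U d"
    using spectral_theorem M posdef_def by blast
  have "posdef (conj_transpose U ** M ** U)"
    using posdef_congruence[OF M, of "conj_transpose U" U] U by (simp add: unitary_matrix_def)
  moreover have "conj_transpose U ** M ** U = real_diag d"
    using U by (simp add: Md spectral_def matrix_mul_assoc[symmetric] unitary_left_cancel)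
      (simp add: unitary_matrix_def)
  ultimately show ?thesis using that[OF U _ Md] by (simp only: posdef_real_diag_iff)
qed

lemma posdef_matrix_powr: "posdef M \<Longrightarrow> posdef (matrix_powr M r)"
  by (erule posdef_obtain_spectral)
    (auto simp: matrix_powr_spectral intro!: posdef_spectral, metis less_irrefl)

lemma posdef_hermitian: "posdef M \<Longrightarrow> conj_transpose M = M"
  by (simp add: posdef_def)

lemma matrix_powr_add: "posdef M \<Longrightarrow> matrix_powr M r ** matrix_powr M s = matrix_powr M (r + s)"
  by (erule posdef_obtain_spectral) (simp add: matrix_powr_spectral spectral_mult powr_add)

lemma matrix_powr_0: "posdef M \<Longrightarrow> matrix_powr M 0 = mat 1" for M :: "complex^'a^'a"
proof (erule posdef_obtain_spectral)
  fix U :: "complex^'a^'a" and d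
  assume "unitary_matrix U" "\<And>i. d i > 0" "M = spectral U d"
  moreover from this(2) have "d i powr 0 = 1" for i by (metis less_irrefl powr_zero_eq_one)
  ultimately show "matrix_powr M 0 = mat 1" by (simp only: matrix_powr_spectral spectral_1)
qed

lemma matrix_powr_1: "posdef M \<Longrightarrow> matrix_powr M 1 = M"
  by (erule posdef_obtain_spectral) (simp add: matrix_powr_spectral less_imp_le)

lemma matrix_powr_commute:
  assumes "posdef M" "S ** M = M ** S"
  shows "S ** matrix_powr M r = matrix_powr M r ** S"
  using assms
  by (elim posdef_obtain_spectral)
    (simp add: matrix_powr_spectral spectral_intertwine[where f = "\<lambda>x. x powr r"])

lemma posdef_invertible: "posdef M \<Longrightarrow> invertible M"
  unfolding invertible_def
  by (rule exI[of _ "matrix_powr M (-1)"])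
    (metis matrix_powr_add matrix_powr_0 matrix_powr_1 add.right_inverse add.left_inverse)

section \<open>Calculus of matrix-valued functions\<close>

lemma bounded_bilinear_matrix_mult:
  "bounded_bilinear ((**) :: complex^'n^'m \<Rightarrow> complex^'k^'n \<Rightarrow> complex^'k^'m)"
  unfolding bilinear_conv_bounded_bilinear[symmetric] bilinear_def
  by (auto intro!: linearI simp: matrix_add_ldistrib matrix_add_rdistrib scaleR_matrix_mult_left
      scaleR_matrix_mult_right)

lemmas matrix_diff_ldistrib = bounded_bilinear.diff_right[OF bounded_bilinear_matrix_mult]

lemmas matrix_diff_rdistrib = bounded_bilinear.diff_left[OF bounded_bilinear_matrix_mult]

lemmas has_vector_derivative_matrix_mult [derivative_intros] =
  bounded_bilinear.has_vector_derivative[OF bounded_bilinear_matrix_mult]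

lemmas tendsto_matrix_mult [tendsto_intros] =
  bounded_bilinear.tendsto[OF bounded_bilinear_matrix_mult]

lemmas continuous_on_matrix_mult [continuous_intros] =
  bounded_bilinear.continuous_on[OF bounded_bilinear_matrix_mult]

text \<open>
  The spectral decomposition into eigenprojections is linear in the eigenvalues, which makes the
  calculus of scalar functions available for them.
\<close>

lemma spectral_sum:
  "spectral U d = (\<Sum>i\<in>UNIV. d i *\<^sub>R spectral U (\<lambda>j. if j = i then 1 else 0))"
proof -
  have "real_diag d = (\<Sum>i\<in>UNIV. d i *\<^sub>R real_diag (\<lambda>j. if j = i then 1 else 0))"
  proof -
    have "(\<Sum>k\<in>UNIV. d k *\<^sub>R real_diag (\<lambda>j. if j = k then 1 else 0)) $ i $ j =
        (\<Sum>k\<in>UNIV. if k = i then if i = j then complex_of_real (d k) else 0 else 0)" for i j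
      unfolding sum_component vector_scaleR_component
      by (rule sum.cong) (auto simp: real_diag_def scaleR_conv_of_real[where 'a = complex])
    thus ?thesis by (simp add: vec_eq_iff real_diag_def)
  qed
  thus ?thesis
    by (simp add: spectral_def scaleR_matrix_mult_left scaleR_matrix_mult_right
      bounded_bilinear.sum_left[OF bounded_bilinear_matrix_mult]
      bounded_bilinear.sum_right[OF bounded_bilinear_matrix_mult])
qed

lemma has_vector_derivative_spectral:
  assumes "\<And>i. ((\<lambda>t. f t i) has_real_derivative f' i) (at t within S)"
  shows "((\<lambda>t. spectral U (f t)) has_vector_derivative spectral U f') (at t within S)"
  by (subst (1 2) spectral_sum) (auto intro!: derivative_eq_intros assms)

lemma has_vector_derivative_matrix_powr:
  assumes "posdef M"
  obtains L where
    "\<And>t. ((\<lambda>t. matrix_powr M t) has_vector_derivative matrix_powr M t ** L) (at t)"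
proof -
  obtain U d where U: "unitary_matrix U" and d: "\<And>i. d i > 0" and M: "M = spectral U d"
    using posdef_obtain_spectral[OF assms] by blast
  \<comment> \<open>The generator \<open>L\<close> is the logarithm of \<open>M\<close>.\<close>
  have "((\<lambda>t. matrix_powr M t) has_vector_derivative
      matrix_powr M t ** spectral U (\<lambda>i. ln (d i))) (at t)" for t
    unfolding M matrix_powr_spectral[OF U d] spectral_mult[OF U]
    by (rule has_vector_derivative_spectral)
      (auto intro!: derivative_eq_intros simp: d less_imp_neq[THEN not_sym])
  thus ?thesis by (rule that)
qed

lemma has_vector_derivative_quotient:
  "(f has_vector_derivative D) (at t within S) \<longleftrightarrow>
    ((\<lambda>s. (f s - f t) /\<^sub>R (s - t)) \<longlongrightarrow> D) (at t within S)"
proof -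
  have "(f has_vector_derivative D) (at t within S) \<longleftrightarrow>
      ((\<lambda>s. (1 / norm (s - t)) *\<^sub>R (f s - (f t + (s - t) *\<^sub>R D))) \<longlongrightarrow> 0) (at t within S)"
    by (simp add: has_vector_derivative_def has_derivative_within bounded_linear_scaleR_left)
  also have "\<dots> \<longleftrightarrow>
      ((\<lambda>s. norm ((1 / norm (s - t)) *\<^sub>R (f s - (f t + (s - t) *\<^sub>R D)))) \<longlongrightarrow> 0) (at t within S)"
    by (rule tendsto_norm_zero_iff[symmetric])
  also have "\<dots> \<longleftrightarrow> ((\<lambda>s. norm ((f s - f t) /\<^sub>R (s - t) - D)) \<longlongrightarrow> 0) (at t within S)"
  proof (rule filterlim_cong[OF refl refl])
    have "norm ((1 / norm (s - t)) *\<^sub>R (f s - (f t + (s - t) *\<^sub>R D))) =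
        norm ((f s - f t) /\<^sub>R (s - t) - D)" if "s \<noteq> t" for s
    proof -
      have "f s - (f t + (s - t) *\<^sub>R D) = (s - t) *\<^sub>R ((f s - f t) /\<^sub>R (s - t) - D)"
        using that by (simp add: scaleR_diff_right)
      thus ?thesis using that by simp
    qed
    thus "\<forall>\<^sub>F s in at t within S. norm ((1 / norm (s - t)) *\<^sub>R (f s - (f t + (s - t) *\<^sub>R D))) =
        norm ((f s - f t) /\<^sub>R (s - t) - D)"
      by (auto simp: eventually_at_filter)
  qed
  also have "\<dots> \<longleftrightarrow> ((\<lambda>s. (f s - f t) /\<^sub>R (s - t)) \<longlongrightarrow> D) (at t within S)"
    by (simp only: tendsto_norm_zero_iff LIM_zero_iff)
  finally show ?thesis .
qed

lemma matrix_inv_inverse: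
  assumes "invertible M"
  shows "M ** matrix_inv M = mat 1" "matrix_inv M ** M = mat 1"
  using someI_ex[OF assms[unfolded invertible_def]] by (simp_all add: matrix_inv_def)

lemma tendsto_det [tendsto_intros]:
  fixes F :: "'a \<Rightarrow> complex^'n^'n"
  assumes "(F \<longlongrightarrow> M) G"
  shows "((\<lambda>x. det (F x)) \<longlongrightarrow> det M) G"
  unfolding det_def by (intro tendsto_intros assms)

text \<open>
  Cramer's rule exhibits the entries of the inverse as rational functions of the entries of \<open>M\<close>, whence
  the continuity of inversion.
\<close>

lemma matrix_inv_cramer:
  fixes M :: "complex^'n^'n"
  assumes "det M \<noteq> 0"
  shows "matrix_inv M =
    (\<chi> k j. det (\<chi> i l. if l = k then (if i = j then 1 else 0) else M $ i $ l) / det M)"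
proof -
  have "M *v (matrix_inv M *v axis j 1) = axis j 1" for j
    using assms by (simp add: matrix_vector_mul_assoc matrix_inv_inverse invertible_det_nz)
  hence "matrix_inv M *v axis j 1 =
      (\<chi> k. det (\<chi> i l. if l = k then axis j 1 $ i else M $ i $ l) / det M)" for j
    using cramer[OF assms] by blast
  moreover have col: "(N *v axis j 1) $ k = N $ k $ j" for N :: "complex^'n^'n" and j k
    by (simp add: matrix_vector_mult_def axis_def if_distrib[of "\<lambda>x. _ * x"]
        cong: if_cong)
  ultimately have "matrix_inv M $ k $ j =
      det (\<chi> i l. if l = k then axis j 1 $ i else M $ i $ l) / det M" for k j
    by (metis (no_types, lifting) vec_lambda_beta)
  thus ?thesis by (simp only: vec_eq_iff axis_def vec_lambda_beta) simp
qed

lemma eventually_invertible: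
  fixes F :: "'a \<Rightarrow> complex^'n^'n"
  assumes "(F \<longlongrightarrow> M) G" "invertible M"
  shows "\<forall>\<^sub>F x in G. invertible (F x)"
  using tendsto_imp_eventually_ne[OF tendsto_det[OF assms(1)], of 0] assms(2)
  by (simp add: invertible_det_nz)

lemma tendsto_matrix_inv:
  fixes F :: "'a \<Rightarrow> complex^'n^'n"
  assumes F: "(F \<longlongrightarrow> M) G" and M: "invertible M"
  shows "((\<lambda>x. matrix_inv (F x)) \<longlongrightarrow> matrix_inv M) G"
proof -
  have dM: "det M \<noteq> 0" using M by (simp add: invertible_det_nz)
  have *: "((\<lambda>x. (\<chi> i l. if l = k then (if i = j then 1 else 0) else F x $ i $ l) :: complex^'n^'n)
      \<longlongrightarrow> (\<chi> i l. if l = k then (if i = j then 1 else 0) else M $ i $ l)) G" for j k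
  proof (intro tendsto_vec_lambda)
    show "((\<lambda>x. if l = k then if i = j then 1 else 0 else F x $ i $ l) \<longlongrightarrow>
        (if l = k then if i = j then 1 else 0 else M $ i $ l)) G" for i l
      by (cases "l = k") (simp_all add: tendsto_vec_nth F)
  qed
  have "((\<lambda>x. (\<chi> k j. det (\<chi> i l. if l = k then (if i = j then 1 else 0) else F x $ i $ l)
      / det (F x))) \<longlongrightarrow> matrix_inv M) G"
    unfolding matrix_inv_cramer[OF dM]
    by (intro tendsto_vec_lambda tendsto_divide[OF tendsto_det[OF *] tendsto_det[OF F] dM])
  moreover have "\<forall>\<^sub>F x in G. (\<chi> k j. det (\<chi> i l. if l = k then (if i = j then 1 else 0)
      else F x $ i $ l) / det (F x)) = matrix_inv (F x)"
    using eventually_invertible[OF F M]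
    by eventually_elim (simp add: matrix_inv_cramer invertible_det_nz)
  ultimately show ?thesis by (rule Lim_transform_eventually)
qed

lemma continuous_on_matrix_inv:
  fixes C :: "'a::topological_space \<Rightarrow> complex^'n^'n"
  assumes "continuous_on S C" "\<And>t. t \<in> S \<Longrightarrow> invertible (C t)"
  shows "continuous_on S (\<lambda>t. matrix_inv (C t))"
  using assms by (auto simp: continuous_on_def intro!: tendsto_matrix_inv)

text \<open>
  Inversion being continuous, this follows in the limit from the identity
  \<open>C(s)\<^sup>-\<^sup>1 - C(t)\<^sup>-\<^sup>1 = - C(s)\<^sup>-\<^sup>1 (C(s) - C(t)) C(t)\<^sup>-\<^sup>1\<close>.
\<close>

lemma has_vector_derivative_matrix_inv:
  fixes C :: "real \<Rightarrow> complex^'n^'n"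
  assumes C: "(C has_vector_derivative C') (at t within S)" and inv: "invertible (C t)"
  shows "((\<lambda>s. matrix_inv (C s)) has_vector_derivative
      - (matrix_inv (C t) ** C' ** matrix_inv (C t))) (at t within S)"
  unfolding has_vector_derivative_quotient
proof -
  have lim: "(C \<longlongrightarrow> C t) (at t within S)"
    using has_vector_derivative_continuous[OF C] by (simp add: continuous_within)
  have "((\<lambda>s. - (matrix_inv (C s) ** ((C s - C t) /\<^sub>R (s - t)) ** matrix_inv (C t))) \<longlongrightarrow>
      - (matrix_inv (C t) ** C' ** matrix_inv (C t))) (at t within S)"
    by (intro tendsto_intros tendsto_matrix_inv[OF lim inv]
        C[unfolded has_vector_derivative_quotient])
  moreover have "\<forall>\<^sub>F s in at t within S.
      - (matrix_inv (C s) ** ((C s - C t) /\<^sub>R (s - t)) ** matrix_inv (C t)) =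
      (matrix_inv (C s) - matrix_inv (C t)) /\<^sub>R (s - t)"
    using eventually_invertible[OF lim inv]
  proof eventually_elim
    case (elim s)
    have "matrix_inv (C s) ** (C s - C t) ** matrix_inv (C t) = matrix_inv (C t) - matrix_inv (C s)"
      using matrix_inv_inverse[OF elim] matrix_inv_inverse[OF inv]
      by (simp add: matrix_diff_ldistrib matrix_diff_rdistrib matrix_mul_assoc[symmetric])
    thus ?case
      by (simp add: scaleR_matrix_mult_left scaleR_matrix_mult_right flip: scaleR_minus_right)
  qed
  ultimately show "((\<lambda>s. (matrix_inv (C s) - matrix_inv (C t)) /\<^sub>R (s - t)) \<longlongrightarrow>
      - (matrix_inv (C t) ** C' ** matrix_inv (C t))) (at t within S)"
    by (rule Lim_transform_eventually)
qed

section \<open>Geodesics in the cone of positive definite matrices\<close>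

definition weighted_geometric_mean :: "complex^'n^'n \<Rightarrow> complex^'n^'n \<Rightarrow> real \<Rightarrow> complex^'n^'n" where
  "weighted_geometric_mean A B t =
    matrix_powr A (1/2) ** matrix_powr (matrix_powr A (-1/2) ** B ** matrix_powr A (-1/2)) t **
    matrix_powr A (1/2)"

lemma matrix_powr_half:
  assumes "posdef A"
  shows "matrix_powr A (1/2) ** matrix_powr A (1/2) = A"
    "matrix_powr A (1/2) ** matrix_powr A (-1/2) = mat 1"
    "matrix_powr A (-1/2) ** matrix_powr A (1/2) = mat 1"
  using assms by (simp_all add: matrix_powr_add matrix_powr_0 matrix_powr_1)

lemma posdef_congruence_powr:
  assumes A: "posdef A" and M: "posdef M"
  shows "posdef (matrix_powr A r ** M ** matrix_powr A r)"
proof -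
  have "matrix_powr A (- r) ** matrix_powr A r = mat 1"
    using A by (simp add: matrix_powr_add matrix_powr_0)
  from posdef_congruence[OF M this] show ?thesis
    by (simp add: posdef_hermitian[OF posdef_matrix_powr[OF A]])
qed

lemma posdef_weighted_geometric_mean:
  "posdef A \<Longrightarrow> posdef B \<Longrightarrow> posdef (weighted_geometric_mean A B t)"
  unfolding weighted_geometric_mean_def by (intro posdef_congruence_powr posdef_matrix_powr)

lemma weighted_geometric_mean_endpoints:
  assumes "posdef A" "posdef B"
  shows "weighted_geometric_mean A B 0 = A" "weighted_geometric_mean A B 1 = B"
proof -
  have pd: "posdef (matrix_powr A (-1/2) ** B ** matrix_powr A (-1/2))"
    using posdef_congruence_powr assms by blast
  show "weighted_geometric_mean A B 0 = A"
    unfolding weighted_geometric_mean_def matrix_powr_0[OF pd] by (simp add: matrix_powr_half assms)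
  have "matrix_powr A (1/2) ** (matrix_powr A (-1/2) ** B ** matrix_powr A (-1/2)) ** matrix_powr A (1/2)
    = (matrix_powr A (1/2) ** matrix_powr A (-1/2)) ** B ** (matrix_powr A (-1/2) ** matrix_powr A (1/2))"
    by (simp only: matrix_mul_assoc)
  thus "weighted_geometric_mean A B 1 = B"
    unfolding weighted_geometric_mean_def matrix_powr_1[OF pd]
    by (simp only: matrix_powr_half[OF assms(1)]) simp
qed

text \<open>
  With \<open>M = A\<^sup>-\<^sup>1\<^sup>/\<^sup>2 B A\<^sup>-\<^sup>1\<^sup>/\<^sup>2\<close> the matrix \<open>K\<close> is \<open>A\<^sup>-\<^sup>1\<^sup>/\<^sup>2 (log M) A\<^sup>1\<^sup>/\<^sup>2\<close>.  What matters is that it is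
  independent of \<open>t\<close>: the second derivative is then the curve times \<open>K\<^sup>2\<close>.
\<close>

lemma weighted_geometric_mean_derivative:
  assumes A: "posdef A" and B: "posdef B"
  obtains K where "\<And>t. ((\<lambda>t. weighted_geometric_mean A B t) has_vector_derivative
      weighted_geometric_mean A B t ** K) (at t)"
proof -
  define R where "R = matrix_powr A (1/2)"
  define S where "S = matrix_powr A (-1/2)"
  define M where "M = S ** B ** S"
  have RS: "R ** S = mat 1" using matrix_powr_half[OF A] by (simp add: R_def S_def)
  have "posdef M" unfolding M_def S_def by (rule posdef_congruence_powr[OF A B])
  then obtain L where
    L: "\<And>t. ((\<lambda>t. matrix_powr M t) has_vector_derivative matrix_powr M t ** L) (at t)"
    using has_vector_derivative_matrix_powr by blast
  have "((\<lambda>t. R ** matrix_powr M t ** R) has_vector_derivative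
      R ** (matrix_powr M t ** L) ** R) (at t)" for t
    by (auto intro!: derivative_eq_intros L)
  moreover have "R ** (matrix_powr M t ** L) ** R = R ** matrix_powr M t ** (R ** S) ** L ** R" for t
    by (simp add: RS matrix_mul_assoc)
  ultimately have "((\<lambda>t. weighted_geometric_mean A B t) has_vector_derivative
      weighted_geometric_mean A B t ** (S ** L ** R)) (at t)" for t
    unfolding weighted_geometric_mean_def R_def[symmetric] S_def[symmetric] M_def[symmetric]
    by (simp add: matrix_mul_assoc)
  thus ?thesis by (rule that)
qed

text \<open>
  The curve is \<open>A exp (\<phi> K)\<close>.  Since \<open>A K\<close> is Hermitian, so is \<open>A\<^sup>1\<^sup>/\<^sup>2 K A\<^sup>-\<^sup>1\<^sup>/\<^sup>2\<close>; in its eigenbasis the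
  equation for \<open>A\<^sup>-\<^sup>1\<^sup>/\<^sup>2 C A\<^sup>-\<^sup>1\<^sup>/\<^sup>2\<close> splits into scalar equations for the entries, solved by
  \<open>exp (h\<^sub>j \<phi>)\<close> on the diagonal and by zero elsewhere.  At \<open>t = 1\<close> this diagonalizes
  \<open>A\<^sup>-\<^sup>1\<^sup>/\<^sup>2 B A\<^sup>-\<^sup>1\<^sup>/\<^sup>2\<close> with eigenvalues \<open>exp h\<^sub>j\<close>, whose powers are read off.
\<close>

lemma exponential_curve_eq_geometric_mean:
  fixes C :: "real \<Rightarrow> complex^'n^'n"
  assumes A: "posdef A" and ends: "C 0 = A" "C 1 = B" "\<phi> 0 = 0" "\<phi> 1 = 1"
    and \<phi>: "\<And>t. t \<in> {0..1} \<Longrightarrow> (\<phi> has_real_derivative \<phi>' t) (at t within {0..1})"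
    and C: "\<And>t. t \<in> {0..1} \<Longrightarrow>
      (C has_vector_derivative \<phi>' t *\<^sub>R (C t ** K)) (at t within {0..1})"
    and herm: "conj_transpose (A ** K) = A ** K"
    and t: "t \<in> {0..1}"
  shows "C t = weighted_geometric_mean A B (\<phi> t)"
proof -
  define R where "R = matrix_powr A (1/2)"
  define S where "S = matrix_powr A (-1/2)"
  have RS: "R ** S = mat 1" "S ** R = mat 1" and RR: "R ** R = A"
    using matrix_powr_half[OF A] by (simp_all add: R_def S_def)
  have S_cancel: "S ** (R ** X) = X" "R ** (S ** X) = X" for X :: "complex^'n^'n"
    by (simp_all add: matrix_mul_assoc RS)
  have S_herm: "conj_transpose S = S"
    using A by (simp add: S_def posdef_hermitian posdef_matrix_powr)
  have SAS: "S ** A ** S = mat 1"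
    by (simp add: RR[symmetric] matrix_mul_assoc[symmetric] S_cancel RS)
  \<comment> \<open>Conjugation by the square root of \<open>A\<close> turns \<open>K\<close> into a Hermitian matrix.\<close>
  define H where "H = R ** K ** S"
  have "H = S ** (A ** K) ** S"
    by (simp add: H_def RR[symmetric] matrix_mul_assoc[symmetric] S_cancel)
  hence "conj_transpose H = H"
    by (simp only: conj_transpose_mult[of "S ** (A ** K)" S] conj_transpose_mult[of S "A ** K"]
        S_herm herm) (simp only: matrix_mul_assoc)
  then obtain U h where U: "unitary_matrix U" and H: "H = spectral U h"
    using spectral_theorem by blast
  have K: "K ** S = S ** spectral U h"
    by (simp add: H[symmetric] H_def matrix_mul_assoc[symmetric] S_cancel)
  define Y where "Y t = conj_transpose U ** (S ** C t ** S) ** U" for t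
  have Y: "(Y has_vector_derivative \<phi>' t *\<^sub>R (Y t ** real_diag h)) (at t within {0..1})"
    if "t \<in> {0..1}" for t
  proof -
    have "(Y has_vector_derivative
        conj_transpose U ** (S ** (\<phi>' t *\<^sub>R (C t ** K)) ** S) ** U) (at t within {0..1})"
      unfolding Y_def by (auto intro!: derivative_eq_intros C that)
    moreover have "conj_transpose U ** (S ** (C t ** K) ** S) ** U = Y t ** real_diag h"
    proof -
      have "conj_transpose U ** (S ** (C t ** K) ** S) ** U =
          conj_transpose U ** S ** C t ** (K ** S) ** U"
        by (simp only: matrix_mul_assoc)
      also have "\<dots> = conj_transpose U ** S ** C t ** (S ** spectral U h) ** U"
        by (simp only: K)
      also have "\<dots> = Y t ** real_diag h ** (conj_transpose U ** U)"
        by (simp only: Y_def spectral_def matrix_mul_assoc)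
      finally show ?thesis using U by (simp add: unitary_matrix_def)
    qed
    ultimately show ?thesis
      by (simp add: scaleR_matrix_mult_left scaleR_matrix_mult_right)
  qed
  have Y0: "Y 0 = mat 1"
    using U by (simp add: Y_def ends SAS unitary_matrix_def)
  have Y_diag: "Y t = real_diag (\<lambda>j. exp (h j * \<phi> t))" if t: "t \<in> {0..1}" for t
  proof -
    have "Y t $ i $ j = real_diag (\<lambda>j. exp (h j * \<phi> t)) $ i $ j" for i j
    proof -
      define y where "y t = Y t $ i $ j" for t
      have y: "(y has_vector_derivative (\<phi>' t * h j) *\<^sub>R y t) (at t within {0..1})"
        if "t \<in> {0..1}" for t
      proof -
        have "bounded_linear (\<lambda>M :: complex^'n^'n. M $ i $ j)"
          by (rule bounded_linear_compose[OF bounded_linear_vec_nth bounded_linear_vec_nth])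
        from bounded_linear.has_vector_derivative[OF this Y[OF that]] show ?thesis
          unfolding y_def
          by (simp add: matrix_mult_real_diag scaleR_conv_of_real[where 'a = complex] mult_ac)
      qed
      have "((\<lambda>t. exp (- (h j * \<phi> t)) *\<^sub>R y t) has_vector_derivative 0) (at t within {0..1})"
        if "t \<in> {0..1}" for t
        by (rule derivative_eq_intros y \<phi> that | simp)+
      then obtain c where c: "\<And>t. t \<in> {0..1} \<Longrightarrow> exp (- (h j * \<phi> t)) *\<^sub>R y t = c"
        using has_vector_derivative_zero_constant[of "{0..1::real}"
          "\<lambda>t. exp (- (h j * \<phi> t)) *\<^sub>R y t"] by (metis convex_real_interval(5))
      have "exp (- (h j * \<phi> t)) *\<^sub>R y t = y 0" using c[OF t] c[of 0] ends by simp
      hence "exp (h j * \<phi> t) *\<^sub>R (exp (- (h j * \<phi> t)) *\<^sub>R y t) = exp (h j * \<phi> t) *\<^sub>R y 0" by simp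
      hence "y t = exp (h j * \<phi> t) *\<^sub>R y 0" by (simp add: exp_minus)
      thus ?thesis
        by (simp add: y_def Y0 real_diag_def mat_def scaleR_conv_of_real[where 'a = complex])
    qed
    thus ?thesis by (simp add: vec_eq_iff)
  qed
  have SCS: "S ** C t ** S = spectral U (\<lambda>j. exp (h j * \<phi> t))" if "t \<in> {0..1}" for t
  proof -
    have "S ** C t ** S = U ** Y t ** conj_transpose U"
      using U by (simp add: Y_def matrix_mul_assoc[symmetric] unitary_left_cancel)
        (simp add: unitary_matrix_def)
    thus ?thesis by (simp add: Y_diag[OF that] spectral_def)
  qed
  have "matrix_powr (S ** B ** S) (\<phi> t) = S ** C t ** S"
    using SCS[of 1] SCS[OF t] ends
    by (simp add: matrix_powr_spectral[OF U] powr_def mult.commute)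
  hence "weighted_geometric_mean A B (\<phi> t) = R ** (S ** C t ** S) ** R"
    by (simp add: weighted_geometric_mean_def R_def S_def)
  also have "\<dots> = C t"
    by (simp add: matrix_mul_assoc[symmetric] S_cancel RS)
  finally show ?thesis ..
qed

text \<open>
  With \<open>F = \<integral>f\<close>, the derivative of \<open>exp (- F) C\<^sup>-\<^sup>1 C'\<close> is
  \<open>exp (- F) C\<^sup>-\<^sup>1 (C'' - C' C\<^sup>-\<^sup>1 C' - f C') = 0\<close>.
\<close>

lemma pregeodesic_first_integral:
  fixes C :: "real \<Rightarrow> complex^'n^'n"
  assumes C: "\<And>t. t \<in> {0..1} \<Longrightarrow> (C has_vector_derivative C' t) (at t within {0..1})"
    and C': "\<And>t. t \<in> {0..1} \<Longrightarrow> (C' has_vector_derivative C'' t) (at t within {0..1})"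
    and inv: "\<And>t. t \<in> {0..1} \<Longrightarrow> invertible (C t)"
    and f: "continuous_on {0..1} f"
    and eq: "\<And>t. t \<in> {0..1} \<Longrightarrow> C'' t = C' t ** matrix_inv (C t) ** C' t + f t *\<^sub>R C' t"
    and t: "t \<in> {0..1}"
  shows "C' t = exp (integral {0..t} f) *\<^sub>R (C t ** (matrix_inv (C 0) ** C' 0))"
proof -
  define F where "F t = integral {0..t} f" for t
  define G where "G t = exp (- F t) *\<^sub>R (matrix_inv (C t) ** C' t)" for t
  have F: "(F has_real_derivative f t) (at t within {0..1})" if "t \<in> {0..1}" for t
    unfolding F_def by (rule integral_has_real_derivative[OF f that])
  have "(G has_vector_derivative 0) (at t within {0..1})" if t: "t \<in> {0..1}" for t
  proof -
    let ?N = "matrix_inv (C t)"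
    have E: "((\<lambda>t. exp (- F t)) has_real_derivative exp (- F t) * - f t) (at t within {0..1})"
      by (auto intro!: derivative_eq_intros F[OF t])
    have "(G has_vector_derivative exp (- F t) *\<^sub>R (?N ** C'' t + - (?N ** C' t ** ?N) ** C' t)
        + (exp (- F t) * - f t) *\<^sub>R (?N ** C' t)) (at t within {0..1})"
      unfolding G_def
      by (intro has_vector_derivative_scaleR[OF E] has_vector_derivative_matrix_mult
          has_vector_derivative_matrix_inv C[OF t] C'[OF t] inv[OF t])
    moreover have "?N ** C'' t + - (?N ** C' t ** ?N) ** C' t = f t *\<^sub>R (?N ** C' t)"
      by (simp add: eq[OF t] matrix_add_ldistrib scaleR_matrix_mult_right matrix_mul_assoc
          bounded_bilinear.minus_left[OF bounded_bilinear_matrix_mult])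
    ultimately show ?thesis by simp
  qed
  then obtain K where K: "\<And>t. t \<in> {0..1} \<Longrightarrow> G t = K"
    using has_vector_derivative_zero_constant[of "{0..1::real}" G]
    by (metis convex_real_interval(5))
  have "G t = G 0" using K t by simp
  also have "G 0 = matrix_inv (C 0) ** C' 0" by (simp add: G_def F_def)
  finally have "exp (F t) *\<^sub>R (C t ** G t) = exp (F t) *\<^sub>R (C t ** (matrix_inv (C 0) ** C' 0))"
    by simp
  moreover have "exp (F t) *\<^sub>R (C t ** G t) = (C t ** matrix_inv (C t)) ** C' t"
    by (simp add: G_def scaleR_matrix_mult_right exp_minus matrix_mul_assoc)
  ultimately show ?thesis
    by (simp add: matrix_inv_inverse[OF inv[OF t]] F_def)
qed

lemma geodesic_equation_unique:
  fixes C :: "real \<Rightarrow> complex^'n^'n"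
  assumes C: "\<And>t. t \<in> {0..1} \<Longrightarrow> (C has_vector_derivative C' t) (at t within {0..1})"
    and C': "\<And>t. t \<in> {0..1} \<Longrightarrow> (C' has_vector_derivative C'' t) (at t within {0..1})"
    and pd: "\<And>t. t \<in> {0..1} \<Longrightarrow> posdef (C t)"
    and eq: "\<And>t. t \<in> {0..1} \<Longrightarrow> C'' t = C' t ** matrix_inv (C t) ** C' t"
    and herm: "conj_transpose (C' 0) = C' 0"
    and t: "t \<in> {0..1}"
  shows "C t = weighted_geometric_mean (C 0) (C 1) t"
proof -
  define K where "K = matrix_inv (C 0) ** C' 0"
  have "C' t = C t ** K" if "t \<in> {0..1}" for t
    using pregeodesic_first_integral[OF C C' posdef_invertible[OF pd], of "\<lambda>_. 0" t] eq that
    by (simp add: K_def)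
  hence "(C has_vector_derivative 1 *\<^sub>R (C t ** K)) (at t within {0..1})" if "t \<in> {0..1}" for t
    using C[OF that] that by simp
  moreover have "C 0 ** K = C' 0"
    using matrix_inv_inverse[OF posdef_invertible[OF pd[of 0]]] by (simp add: K_def matrix_mul_assoc)
  ultimately show ?thesis
    using exponential_curve_eq_geometric_mean[of "C 0" C "C 1" "\<lambda>t. t" "\<lambda>_. 1" K t] pd[of 0] herm t
    by (simp add: DERIV_ident)
qed

text \<open>
  The reparametrization is \<open>\<Phi> / s\<close> with \<open>\<Phi>' = e = exp (\<integral>f)\<close> and \<open>s = \<Phi> 1\<close>, which is the normalized arc
  length unless the curve is constant.  Replacing \<open>K\<close> with \<open>s K\<close> compensates for the normalization.
\<close>

lemma pregeodesic_equation_unique: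
  fixes C :: "real \<Rightarrow> complex^'n^'n"
  assumes C: "\<And>t. t \<in> {0..1} \<Longrightarrow> (C has_vector_derivative C' t) (at t within {0..1})"
    and C': "\<And>t. t \<in> {0..1} \<Longrightarrow> (C' has_vector_derivative C'' t) (at t within {0..1})"
    and pd: "\<And>t. t \<in> {0..1} \<Longrightarrow> posdef (C t)"
    and f: "continuous_on {0..1} f"
    and eq: "\<And>t. t \<in> {0..1} \<Longrightarrow> C'' t = C' t ** matrix_inv (C t) ** C' t + f t *\<^sub>R C' t"
    and herm: "conj_transpose (C' 0) = C' 0"
  shows "reparametrization_of C (weighted_geometric_mean (C 0) (C 1))"
proof -
  define K where "K = matrix_inv (C 0) ** C' 0"
  define e where "e t = exp (integral {0..t} f)" for t
  define \<Phi> where "\<Phi> t = integral {0..t} e" for t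
  define s where "s = \<Phi> 1"
  have C'_eq: "C' t = e t *\<^sub>R (C t ** K)" if "t \<in> {0..1}" for t
    unfolding K_def e_def
    using pregeodesic_first_integral[OF C C' posdef_invertible[OF pd] f eq] that by blast
  have e_cont: "continuous_on {0..1} e"
    unfolding e_def
    by (intro continuous_on_exp indefinite_integral_continuous_1 integrable_continuous_real f)
  have \<Phi>: "(\<Phi> has_real_derivative e t) (at t within {0..1})" if "t \<in> {0..1}" for t
    unfolding \<Phi>_def by (rule integral_has_real_derivative[OF e_cont that])
  have \<Phi>0: "\<Phi> 0 = 0" by (simp add: \<Phi>_def)
  have "\<exists>x\<in>{0<..<1}. \<Phi> 1 - \<Phi> 0 = e x * (1 - 0)"
    by (rule mvt_simple) (use \<Phi> in \<open>auto simp: has_field_derivative_def\<close>)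
  hence s: "s > 0" by (auto simp: s_def \<Phi>0 e_def)
  have K0: "C 0 ** K = C' 0"
    using matrix_inv_inverse[OF posdef_invertible[OF pd[of 0]]] by (simp add: K_def matrix_mul_assoc)
  have conj_scaleR: "conj_transpose (r *\<^sub>R M) = r *\<^sub>R conj_transpose M" for r and M :: "complex^'n^'n"
    by (simp add: conj_transpose_def vec_eq_iff)
  have C_eq: "C t = weighted_geometric_mean (C 0) (C 1) (\<Phi> t / s)" if "t \<in> {0..1}" for t
  proof (rule exponential_curve_eq_geometric_mean[OF _ refl refl, where \<phi>' = "\<lambda>t. e t / s"])
    show "posdef (C 0)" using pd by simp
    show "\<Phi> 0 / s = 0" "\<Phi> 1 / s = 1" using s by (simp_all add: \<Phi>0 s_def)
    show "((\<lambda>t. \<Phi> t / s) has_real_derivative e t / s) (at t within {0..1})"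
      if "t \<in> {0..1}" for t
      using \<Phi>[OF that] by (rule DERIV_cdivide)
    show "(C has_vector_derivative (e t / s) *\<^sub>R (C t ** (s *\<^sub>R K))) (at t within {0..1})"
      if "t \<in> {0..1}" for t
      using C[OF that] C'_eq[OF that] s by (simp add: scaleR_matrix_mult_right)
    show "conj_transpose (C 0 ** s *\<^sub>R K) = C 0 ** s *\<^sub>R K"
      by (simp add: scaleR_matrix_mult_right K0 conj_scaleR herm)
  qed fact
  show ?thesis
    unfolding reparametrization_of_def
  proof (intro exI conjI ballI)
    show "\<Phi> 0 / s = 0" "\<Phi> 1 / s = 1" using s by (simp_all add: \<Phi>0 s_def)
    show "continuous_on {0..1} (\<lambda>t. e t / s)" using s by (intro continuous_intros e_cont) auto
    show "((\<lambda>t. \<Phi> t / s) has_real_derivative e t / s) (at t within {0..1})"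
      if "t \<in> {0..1}" for t using \<Phi>[OF that] by (rule DERIV_cdivide)
    show "e t / s > 0" for t using s by (simp add: e_def)
    show "C t = weighted_geometric_mean (C 0) (C 1) (\<Phi> t / s)" if "t \<in> {0..1}" for t
      using C_eq that by blast
  qed
qed

section \<open>Tensors as block circulant matrices\<close>

lemma pos_less_card: "pos (k :: 'p::{finite,linorder}) < int CARD('p)"
proof -
  have "{l. l < k} \<subset> (UNIV :: 'p set)" by auto
  thus ?thesis by (simp add: pos_def psubset_card_mono)
qed

lemma pos_nonneg: "0 \<le> pos k"
  by (simp add: pos_def)

lemma inj_pos: "inj (pos :: 'p::{finite,linorder} \<Rightarrow> int)"
proof (rule linorder_injI)
  fix k l :: 'p assume "k < l"
  hence "{m. m < k} \<subset> {m. m < l}" by auto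
  hence "card {m. m < k} < card {m. m < l}" by (intro psubset_card_mono) auto
  thus "pos k \<noteq> pos l" by (simp add: pos_def)
qed

lemma range_pos: "range (pos :: 'p::{finite,linorder} \<Rightarrow> int) = {0..<int CARD('p)}"
  by (rule card_subset_eq) (auto simp: pos_less_card pos_nonneg card_image[OF inj_pos])

lemma pos_idx: "pos (idx i :: 'p::{finite,linorder}) = i mod int CARD('p)"
proof -
  have "i mod int CARD('p) \<in> range (pos :: 'p \<Rightarrow> int)" by (simp add: range_pos)
  then obtain k :: 'p where k: "pos k = i mod int CARD('p)" by (metis rangeE)
  thus ?thesis unfolding idx_def
    by (rule theI[where P = "\<lambda>k :: 'p. pos k = i mod int CARD('p)"]) (metis k injD inj_pos)
qed

lemma idx_eq_iff:
  "(idx i :: 'p::{finite,linorder}) = idx j \<longleftrightarrow> i mod int CARD('p) = j mod int CARD('p)"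
  by (metis pos_idx injD inj_pos)

lemma idx_pos [simp]: "idx (pos k) = (k :: 'p::{finite,linorder})"
  by (rule injD[OF inj_pos]) (simp add: pos_idx pos_less_card pos_nonneg)

lemma idx_pos_idx [simp]:
  "idx (pos (idx i :: 'p) + j) = (idx (i + j) :: 'p::{finite,linorder})"
  "idx (j + pos (idx i :: 'p)) = (idx (j + i) :: 'p)"
  "idx (pos (idx i :: 'p) - j) = (idx (i - j) :: 'p)"
  "idx (j - pos (idx i :: 'p)) = (idx (j - i) :: 'p)"
  "idx (- pos (idx i :: 'p)) = (idx (- i) :: 'p)"
  by (simp_all add: idx_eq_iff pos_idx mod_simps)

lemma idx_eq_shift:
  fixes k l :: "'p::{finite,linorder}"
  shows "idx (pos k - pos l) = (idx s :: 'p) \<longleftrightarrow> l = idx (pos k - s)"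
    and "idx (pos k - pos l) = (idx s :: 'p) \<longleftrightarrow> k = idx (pos l + s)"
proof -
  have "l = idx (pos k - s)" if "idx (pos k - pos l) = (idx s :: 'p)"
  proof -
    have "idx (pos k - pos (idx (pos k - pos l) :: 'p)) = (idx (pos k - pos (idx s :: 'p)) :: 'p)"
      using that by simp
    thus ?thesis by simp
  qed
  moreover have "k = idx (pos l + s)" if "idx (pos k - pos l) = (idx s :: 'p)"
  proof -
    have "idx (pos l + pos (idx (pos k - pos l) :: 'p)) = (idx (pos l + pos (idx s :: 'p)) :: 'p)"
      using that by simp
    thus ?thesis by simp
  qed
  ultimately show "idx (pos k - pos l) = (idx s :: 'p) \<longleftrightarrow> l = idx (pos k - s)"
    and "idx (pos k - pos l) = (idx s :: 'p) \<longleftrightarrow> k = idx (pos l + s)"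
    by auto
qed

lemma bcirc_nth: "bcirc A $ r $ c = A $ idx (pos (fst r) - pos (fst c)) $ snd r $ snd c"
  by (simp add: bcirc_def)

text \<open>
  A block circulant matrix is determined by its first block column, so this is a linear left
  inverse of \<^const>\<open>bcirc\<close>.
\<close>

definition first_block_column ::
    "complex^('p::{finite,linorder} \<times> 'n)^('p \<times> 'm) \<Rightarrow> complex^'n^'m^'p::{finite,linorder}" where
  "first_block_column M = (\<chi> k i j. M $ (k, i) $ (idx 0, j))"

lemma first_block_column_bcirc [simp]: "first_block_column (bcirc A) = A"
  by (simp add: first_block_column_def bcirc_nth vec_eq_iff)

lemma bcirc_eq_iff: "bcirc A = bcirc B \<longleftrightarrow> A = B"
  by (metis first_block_column_bcirc)

lemma bounded_linear_bcirc:
  "bounded_linear (bcirc :: complex^'n^'m^'p::{finite,linorder} \<Rightarrow> complex^('p \<times> 'n)^('p \<times> 'm))"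
  unfolding linear_conv_bounded_linear[symmetric]
  by (rule linearI) (simp_all add: bcirc_nth vec_eq_iff)

lemma bounded_linear_first_block_column:
  "bounded_linear (first_block_column ::
     complex^('p::{finite,linorder} \<times> 'n)^('p \<times> 'm) \<Rightarrow> complex^'n^'m^'p::{finite,linorder})"
  unfolding linear_conv_bounded_linear[symmetric]
  by (rule linearI) (simp_all add: first_block_column_def vec_eq_iff)

lemmas bcirc_linear =
  linear_add[OF bounded_linear.linear[OF bounded_linear_bcirc]]
  linear_diff[OF bounded_linear.linear[OF bounded_linear_bcirc]]
  linear_cmul[OF bounded_linear.linear[OF bounded_linear_bcirc]]
  linear_0[OF bounded_linear.linear[OF bounded_linear_bcirc]]

lemma bcirc_tprod:
  fixes A :: "complex^'n^'m^'p::{finite,linorder}" and B :: "complex^'q^'n^'p::{finite,linorder}"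
  shows "bcirc (A \<star> B) = bcirc A ** bcirc B"
proof -
  have "bcirc (A \<star> B) $ (k, i) $ (c, j) = (bcirc A ** bcirc B) $ (k, i) $ (c, j)" for k c i j
  proof -
    have "bcirc (A \<star> B) $ (k, i) $ (c, j) =
        (\<Sum>r\<in>UNIV. A $ idx (pos k - pos c - pos (fst r)) $ i $ snd r * B $ fst r $ snd r $ j)"
      by (simp add: bcirc_nth tprod_def fold_tensor_def matrix_matrix_mult_def unfold_tensor_def)
    \<comment> \<open>Translating the summation index by the position of \<open>c\<close> turns one convolution into the other.\<close>
    also have "\<dots> = (\<Sum>r\<in>UNIV. A $ idx (pos k - pos (fst r :: 'p)) $ i $ snd r *
        B $ idx (pos (fst r) - pos c) $ snd r $ j)"
      by (rule sum.reindex_bij_witness[of _ "\<lambda>r. (idx (pos (fst r) - pos c), snd r)"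
            "\<lambda>r. (idx (pos (fst r) + pos c), snd r)"]) (auto simp: algebra_simps)
    also have "\<dots> = (bcirc A ** bcirc B) $ (k, i) $ (c, j)"
      by (simp add: bcirc_nth matrix_matrix_mult_def)
    finally show ?thesis .
  qed
  thus ?thesis by (simp add: vec_eq_iff)
qed

lemma bcirc_tident: "bcirc tident = mat 1"
proof -
  have "idx (pos k - pos l) = (idx 0 :: 'p) \<longleftrightarrow> k = l" for k l :: "'p::{finite,linorder}"
    by (auto simp: idx_eq_shift(1))
  thus ?thesis by (auto simp: vec_eq_iff bcirc_nth tident_def mat_def)
qed

lemma bcirc_tconj_transpose: "bcirc (tconj_transpose A) = conj_transpose (bcirc A)"
  by (simp add: vec_eq_iff bcirc_nth tconj_transpose_def conj_transpose_def)

lemma THerm_iff: "A \<in> THerm \<longleftrightarrow> conj_transpose (bcirc A) = bcirc A"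
  by (simp add: THerm_def bcirc_tconj_transpose[symmetric] bcirc_eq_iff)

definition tensor_column :: "complex^1^'n^'p \<Rightarrow> complex^('p \<times> 'n)" where
  "tensor_column X = (\<chi> r. X $ fst r $ snd r $ 1)"

lemma tinner_tprod:
  "tinner X (A \<star> X) = cdot (tensor_column X) (bcirc A *v tensor_column X)"
proof -
  have "tinner X Y = cdot (tensor_column X) (tensor_column Y)" for Y
    by (simp add: tinner_def cdot_def tensor_column_def UNIV_Times_UNIV[symmetric]
        sum.cartesian_product' del: UNIV_Times_UNIV)
  moreover have "tensor_column (A \<star> X) = bcirc A *v tensor_column X"
    by (simp add: tensor_column_def tprod_def fold_tensor_def matrix_matrix_mult_def
        matrix_vector_mult_def unfold_tensor_def vec_eq_iff)
  ultimately show ?thesis by simp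
qed

lemma TPD_iff: "A \<in> TPD \<longleftrightarrow> posdef (bcirc A)"
proof -
  have real: "tinner X (A \<star> X) \<in> \<real>" if "conj_transpose (bcirc A) = bcirc A"
    for X :: "complex^1^'a^'b::{finite,linorder}"
    unfolding Reals_cnj_iff tinner_tprod cnj_cdot
    using cdot_matrix_left[of "tensor_column X" "bcirc A" "tensor_column X"] that by simp
  have "(\<forall>X :: complex^1^'a^'b::{finite,linorder}. X \<noteq> 0 \<longrightarrow> 0 < Re (tinner X (A \<star> X))) \<longleftrightarrow>
      (\<forall>x. x \<noteq> 0 \<longrightarrow> 0 < x \<bullet> (bcirc A *v x))"
  proof (intro iffI allI impI)
    fix x :: "complex^('b \<times> 'a)"
    assume *: "\<forall>X :: complex^1^'a^'b::{finite,linorder}. X \<noteq> 0 \<longrightarrow> 0 < Re (tinner X (A \<star> X))" and "x \<noteq> 0"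
    define X :: "complex^1^'a^'b::{finite,linorder}" where "X = (\<chi> k i j. x $ (k, i))"
    have x: "tensor_column X = x" by (simp add: X_def tensor_column_def vec_eq_iff)
    moreover have "tensor_column 0 = 0" by (simp add: tensor_column_def vec_eq_iff)
    ultimately have "X \<noteq> 0" using \<open>x \<noteq> 0\<close> by metis
    with * have "0 < Re (tinner X (A \<star> X))" by blast
    thus "0 < x \<bullet> (bcirc A *v x)" by (simp add: tinner_tprod x inner_eq_Re_cdot)
  next
    fix X :: "complex^1^'a^'b::{finite,linorder}"
    assume *: "\<forall>x. x \<noteq> 0 \<longrightarrow> 0 < x \<bullet> (bcirc A *v x)" and "X \<noteq> 0"
    hence "tensor_column X \<noteq> 0"
      by (auto simp: tensor_column_def vec_eq_iff)
    thus "0 < Re (tinner X (A \<star> X))" using * by (simp add: tinner_tprod inner_eq_Re_cdot)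
  qed
  thus ?thesis using real unfolding TPD_def posdef_def THerm_iff by blast
qed

text \<open>
  The permutation matrix that moves block \<open>k\<close> to block \<open>k + s\<close>; its commutant detects block
  circulant matrices.
\<close>

definition block_shift :: "int \<Rightarrow> complex^('p::{finite,linorder} \<times> 'n::finite)^('p \<times> 'n)" where
  "block_shift s = bcirc (\<chi> k. if k = idx s then mat 1 else 0)"

lemma block_shift_nth:
  "block_shift s $ r $ c = (if c = (idx (pos (fst r) - s), snd r) then 1 else 0)"
  "block_shift s $ r $ c = (if r = (idx (pos (fst c) + s), snd c) then 1 else 0)"
  by (auto simp: block_shift_def bcirc_nth idx_eq_shift(1) mat_def prod_eq_iff)

lemma block_shift_mult: "(block_shift s ** M) $ (k, i) $ c = M $ (idx (pos k - s), i) $ c"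
  by (simp add: matrix_matrix_mult_def block_shift_nth(1) if_distrib[of "\<lambda>x. x * _"] cong: if_cong)

lemma mult_block_shift: "(M ** block_shift s) $ r $ (l, j) = M $ r $ (idx (pos l + s), j)"
  by (simp add: matrix_matrix_mult_def block_shift_nth(2) if_distrib[of "\<lambda>x. _ * x"] cong: if_cong)

lemma block_shift_commute: "block_shift s ** bcirc A = bcirc A ** block_shift s"
proof -
  have "(block_shift s ** bcirc A) $ (k, i) $ (l, j) = (bcirc A ** block_shift s) $ (k, i) $ (l, j)"
    for k i l j
    unfolding block_shift_mult mult_block_shift by (simp add: bcirc_nth algebra_simps)
  thus ?thesis by (simp add: vec_eq_iff)
qed

text \<open>
  Commuting with the shift by the position of \<open>l\<close> moves the block in column \<open>l\<close> and row \<open>k\<close> to the first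
  column and row \<open>k - l\<close>.
\<close>

lemma commuting_block_shift_imp_bcirc:
  fixes M :: "complex^('p::{finite,linorder} \<times> 'n::finite)^('p \<times> 'n)"
  assumes "\<And>s. block_shift s ** M = M ** block_shift s"
  shows "bcirc (first_block_column M) = M"
proof -
  have "M $ (k, i) $ (l, j) = M $ (idx (pos k - pos l), i) $ (idx 0, j)" for k i l j
  proof -
    have "(M ** block_shift (pos l)) $ (k, i) $ (idx 0, j) =
        (block_shift (pos l) ** M) $ (k, i) $ (idx 0, j)" using assms by simp
    thus ?thesis unfolding block_shift_mult mult_block_shift by simp
  qed
  thus ?thesis by (simp add: vec_eq_iff bcirc_nth first_block_column_def)
qed

text \<open>
  The inverse of \<open>bcirc A\<close> commutes with the block shifts because \<open>bcirc A\<close> does, so it comes from a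
  tensor.
\<close>

lemma bcirc_tinv:
  fixes A :: "complex^'n^'n^'p::{finite,linorder}"
  assumes inv: "invertible (bcirc A)"
  shows "bcirc (tinv A) = matrix_inv (bcirc A)"
proof -
  let ?M = "bcirc A" and ?N = "matrix_inv (bcirc A)"
  note MN = matrix_inv_inverse[OF inv]
  have "block_shift s ** ?N = ?N ** block_shift s" for s
  proof -
    have "block_shift s ** ?N = ?N ** (?M ** block_shift s) ** ?N"
      by (simp add: matrix_mul_assoc MN)
    also have "\<dots> = ?N ** block_shift s ** (?M ** ?N)"
      by (simp only: block_shift_commute[symmetric] matrix_mul_assoc)
    finally show ?thesis by (simp add: MN)
  qed
  from commuting_block_shift_imp_bcirc[OF this]
  obtain B where B: "bcirc B = ?N" by blast
  have "tinv A = B"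
    unfolding tinv_def
  proof (rule the_equality)
    show "A \<star> B = tident \<and> B \<star> A = tident"
      unfolding bcirc_eq_iff[symmetric] bcirc_tprod bcirc_tident B by (simp add: MN)
    fix C assume "A \<star> C = tident \<and> C \<star> A = tident"
    hence "bcirc C ** ?M = mat 1"
      unfolding bcirc_eq_iff[symmetric] bcirc_tprod bcirc_tident by simp
    hence "bcirc C ** (?M ** ?N) = ?N" by (simp add: matrix_mul_assoc)
    hence "bcirc C = ?N" by (simp add: MN)
    thus "C = B" using B bcirc_eq_iff by metis
  qed
  thus ?thesis using B by simp
qed

lemma bcirc_tpowr:
  assumes "A \<in> TPD"
  shows "bcirc (tpowr A r) = matrix_powr (bcirc A) r"
proof -
  have "block_shift s ** matrix_powr (bcirc A) r = matrix_powr (bcirc A) r ** block_shift s" for s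
    using assms by (intro matrix_powr_commute block_shift_commute) (simp add: TPD_iff)
  from commuting_block_shift_imp_bcirc[OF this]
  obtain B where B: "bcirc B = matrix_powr (bcirc A) r" by blast
  have "tpowr A r = B"
    unfolding tpowr_def B[symmetric] bcirc_eq_iff by simp
  thus ?thesis using B by simp
qed

section \<open>The covariant acceleration\<close>

lemma tmetric_eq:
  assumes "invertible (bcirc P)"
  shows "tmetric P X Y =
    Re (trace (matrix_inv (bcirc P) ** bcirc X ** matrix_inv (bcirc P) ** bcirc Y))"
  by (simp add: tmetric_def ttrace_def bcirc_tprod bcirc_tinv assms)

lemma bounded_linear_Re_trace: "bounded_linear (\<lambda>M :: complex^'n^'n. Re (trace M))"
  unfolding linear_conv_bounded_linear[symmetric]
  by (rule linearI) (simp_all add: trace_def sum.distrib scaleR_sum_right sum_distrib_left)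

text \<open>
  Only values of the metric near \<open>P\<close> enter, where invertibility persists, so that \<^const>\<open>tinv\<close> may be
  replaced by the matrix inverse.
\<close>

lemma metric_deriv_tmetric:
  assumes P: "invertible (bcirc P)"
  defines "N \<equiv> matrix_inv (bcirc P)"
  shows "metric_deriv tmetric P W X Y =
    - Re (trace (N ** bcirc W ** N ** bcirc X ** N ** bcirc Y))
    - Re (trace (N ** bcirc X ** N ** bcirc W ** N ** bcirc Y))"
proof -
  define C where "C s = bcirc P + s *\<^sub>R bcirc W" for s
  define h where "h s = Re (trace (matrix_inv (C s) ** bcirc X ** matrix_inv (C s) ** bcirc Y))" for s
  have C0: "C 0 = bcirc P" by (simp add: C_def)
  have "(C \<longlongrightarrow> bcirc P + 0 *\<^sub>R bcirc W) (nhds 0)"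
    unfolding C_def by (intro tendsto_intros filterlim_ident)
  hence "\<forall>\<^sub>F s in nhds 0. invertible (C s)"
    using eventually_invertible P by fastforce
  hence "\<forall>\<^sub>F s in nhds 0. tmetric (P + s *\<^sub>R W) X Y = h s"
    by eventually_elim (simp add: tmetric_eq C_def h_def bcirc_linear)
  hence "metric_deriv tmetric P W X Y = deriv h 0"
    unfolding metric_deriv_def by (rule deriv_cong_ev) simp
  also have "\<dots> = Re (trace ((N ** bcirc X ** - (N ** bcirc W ** N) +
      - (N ** bcirc W ** N) ** bcirc X ** N) ** bcirc Y))"
  proof (rule DERIV_imp_deriv)
    have "(C has_vector_derivative bcirc W) (at 0)"
      unfolding C_def by (auto intro!: derivative_eq_intros)
    from has_vector_derivative_matrix_inv[OF this] P
    have inv: "((\<lambda>s. matrix_inv (C s)) has_vector_derivative - (N ** bcirc W ** N)) (at 0)"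
      by (simp add: C0 N_def)
    have "((\<lambda>s. matrix_inv (C s) ** bcirc X ** matrix_inv (C s) ** bcirc Y) has_vector_derivative
        (N ** bcirc X ** - (N ** bcirc W ** N) + - (N ** bcirc W ** N) ** bcirc X ** N) ** bcirc Y)
        (at 0)"
      by (rule derivative_eq_intros inv refl)+ (simp add: C0 N_def)
    from bounded_linear.has_vector_derivative[OF bounded_linear_Re_trace this]
    show "(h has_real_derivative Re (trace ((N ** bcirc X ** - (N ** bcirc W ** N) +
        - (N ** bcirc W ** N) ** bcirc X ** N) ** bcirc Y))) (at 0)"
      by (simp add: h_def[abs_def] has_real_derivative_iff_has_vector_derivative)
  qed
  finally show ?thesis
    by (simp add: matrix_add_rdistrib matrix_diff_rdistrib matrix_mul_assoc
        bounded_bilinear.minus_left[OF bounded_bilinear_matrix_mult]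
        bounded_bilinear.minus_right[OF bounded_bilinear_matrix_mult]
        linear_diff[OF bounded_linear.linear[OF bounded_linear_Re_trace]]
        linear_neg[OF bounded_linear.linear[OF bounded_linear_Re_trace]])
qed

text \<open>
  By cyclicity of the trace the three metric derivatives are \<open>-2 T\<close>, \<open>-2 T\<close> and \<open>-2 T\<close> for the same trace
  \<open>T\<close>, and enter the Koszul formula with signs \<open>+\<close>, \<open>+\<close>, \<open>-\<close>.
\<close>

lemma christoffel_tmetric:
  assumes P: "invertible (bcirc P)"
  defines "N \<equiv> matrix_inv (bcirc P)"
  shows "christoffel tmetric P V V Z = - Re (trace (N ** (bcirc V ** N ** bcirc V) ** N ** bcirc Z))"
proof -
  let ?v = "bcirc V" and ?z = "bcirc Z"
  have "trace (N ** ?z ** N ** ?v ** N ** ?v) = trace (N ** ?v ** N ** ?v ** N ** ?z)"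
    using trace_mul_sym[of "N ** ?z" "N ** ?v ** N ** ?v"] by (simp add: matrix_mul_assoc)
  moreover have "trace (N ** ?v ** N ** ?z ** N ** ?v) = trace (N ** ?v ** N ** ?v ** N ** ?z)"
    using trace_mul_sym[of "N ** ?v ** N ** ?z" "N ** ?v"] by (simp add: matrix_mul_assoc)
  ultimately show ?thesis
    by (simp add: christoffel_def metric_deriv_tmetric[OF P] N_def[symmetric] matrix_mul_assoc)
qed

lemma Re_trace_conj_transpose_mult: "Re (trace (conj_transpose E ** E)) = E \<bullet> E"
  for E :: "complex^'n^'m"
proof -
  have "Re (trace (conj_transpose E ** E)) = (\<Sum>j\<in>UNIV. \<Sum>i\<in>UNIV. E $ i $ j \<bullet> E $ i $ j)"
    by (simp add: trace_def matrix_matrix_mult_def conj_transpose_def inner_complex_def)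
  also have "\<dots> = E \<bullet> E" unfolding inner_vec_def by (rule sum.swap)
  finally show ?thesis .
qed

text \<open>
  By the formula for the Christoffel symbols, a Hermitian \<open>D\<close> is the covariant acceleration exactly if
  the defect \<open>E = D - a + v P\<^sup>-\<^sup>1 v\<close>, itself Hermitian, is orthogonal to all Hermitian \<open>Z\<close> at \<open>P\<close>.
  Testing with \<open>Z = P E P\<close> gives
  \<open>0 = tr (P\<^sup>-\<^sup>1 E P\<^sup>-\<^sup>1 P E P) = tr (E E)\<close>, the squared Frobenius norm of \<open>E\<close>.
\<close>

lemma is_cov_accel_tmetric_iff:
  fixes P :: "complex^'n^'n^'p::{finite,linorder}"
  assumes P: "P \<in> TPD" and v: "v \<in> THerm" and a: "a \<in> THerm"
  shows "is_cov_accel tmetric THerm P v a D \<longleftrightarrow>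
    D \<in> THerm \<and> bcirc D = bcirc a - bcirc v ** matrix_inv (bcirc P) ** bcirc v"
proof (cases "D \<in> THerm")
  case D: True
  have inv: "invertible (bcirc P)" using P by (simp add: TPD_iff posdef_invertible)
  define N where "N = matrix_inv (bcirc P)"
  note PN = matrix_inv_inverse[OF inv, folded N_def]
  define E where "E = D - a + v \<star> tinv P \<star> v"
  have bE: "bcirc E = bcirc D - bcirc a + bcirc v ** N ** bcirc v"
    by (simp add: E_def bcirc_linear bcirc_tprod bcirc_tinv[OF inv] N_def)
  have split: "Re (trace (N ** bcirc E ** N ** bcirc Z)) = Re (trace (N ** bcirc D ** N ** bcirc Z)) -
      Re (trace (N ** bcirc a ** N ** bcirc Z)) +
      Re (trace (N ** (bcirc v ** N ** bcirc v) ** N ** bcirc Z))" for Z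
    unfolding bE
    by (simp only: matrix_add_ldistrib matrix_add_rdistrib matrix_diff_ldistrib matrix_diff_rdistrib
        linear_add[OF bounded_linear.linear[OF bounded_linear_Re_trace]]
        linear_diff[OF bounded_linear.linear[OF bounded_linear_Re_trace]])
  have defect: "tmetric P D Z = tmetric P a Z + christoffel tmetric P v v Z \<longleftrightarrow>
      Re (trace (N ** bcirc E ** N ** bcirc Z)) = 0" for Z
    unfolding tmetric_eq[OF inv] christoffel_tmetric[OF inv] N_def[symmetric] split
    by (rule iffI) linarith+
  have "bcirc E = 0" if *: "\<And>Z. Z \<in> THerm \<Longrightarrow> Re (trace (N ** bcirc E ** N ** bcirc Z)) = 0"
  proof -
    have N_herm: "conj_transpose N = N"
    proof -
      have "conj_transpose N ** bcirc P = mat 1"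
        using arg_cong[OF PN(1), of conj_transpose] P
        by (simp add: conj_transpose_mult TPD_iff posdef_hermitian)
      hence "conj_transpose N ** (bcirc P ** N) = N" by (simp add: matrix_mul_assoc)
      thus ?thesis by (simp add: PN)
    qed
    have conj_lin: "conj_transpose (X + Y) = conj_transpose X + conj_transpose Y"
      "conj_transpose (X - Y) = conj_transpose X - conj_transpose Y" for X Y :: "complex^('p \<times> 'n)^('p \<times> 'n)"
      by (simp_all add: conj_transpose_def vec_eq_iff)
    have E_herm: "conj_transpose (bcirc E) = bcirc E"
      using a v D by (simp add: bE conj_lin THerm_iff conj_transpose_mult N_herm matrix_mul_assoc)
    have "P \<star> E \<star> P \<in> THerm"
      using P by (simp add: THerm_iff bcirc_tprod conj_transpose_mult E_herm TPD_iff
          posdef_hermitian matrix_mul_assoc)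
    from *[OF this] have "Re (trace (N ** bcirc E ** N ** (bcirc P ** bcirc E ** bcirc P))) = 0"
      by (simp add: bcirc_tprod)
    also have "N ** bcirc E ** N ** (bcirc P ** bcirc E ** bcirc P) =
        N ** (bcirc E ** (N ** bcirc P) ** bcirc E ** bcirc P)"
      by (simp only: matrix_mul_assoc)
    also have "trace \<dots> = trace (bcirc E ** (N ** bcirc P) ** bcirc E ** bcirc P ** N)"
      by (rule trace_mul_sym)
    also have "bcirc E ** (N ** bcirc P) ** bcirc E ** bcirc P ** N = bcirc E ** bcirc E"
      by (simp add: PN matrix_mul_assoc[symmetric])
    finally have "Re (trace (bcirc E ** bcirc E)) = 0" .
    thus "bcirc E = 0" using Re_trace_conj_transpose_mult[of "bcirc E"] E_herm by simp
  qed
  moreover have "bcirc E = 0 \<longleftrightarrow> bcirc D = bcirc a - bcirc v ** N ** bcirc v"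
    by (auto simp: bE algebra_simps)
  moreover have "Re (trace (N ** bcirc E ** N ** bcirc Z)) = 0" if "bcirc E = 0" for Z
    using that by (simp add: trace_def)
  ultimately show ?thesis
    using D unfolding is_cov_accel_def defect N_def[symmetric] by blast
qed (simp add: is_cov_accel_def)

section \<open>Geodesics in the cone of T-positive definite tensors\<close>

definition tensor_geometric_mean ::
    "complex^'n^'n^'p::{finite,linorder} \<Rightarrow> complex^'n^'n^'p::{finite,linorder} \<Rightarrow> real \<Rightarrow>
     complex^'n^'n^'p::{finite,linorder}" where
  "tensor_geometric_mean A B t =
    tpowr A (1/2) \<star> tpowr (tpowr A (-1/2) \<star> B \<star> tpowr A (-1/2)) t \<star> tpowr A (1/2)"

lemma bcirc_tensor_geometric_mean:
  assumes "A \<in> TPD" "B \<in> TPD"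
  shows "bcirc (tensor_geometric_mean A B t) = weighted_geometric_mean (bcirc A) (bcirc B) t"
proof -
  have M: "bcirc (tpowr A (-1/2) \<star> B \<star> tpowr A (-1/2)) =
      matrix_powr (bcirc A) (-1/2) ** bcirc B ** matrix_powr (bcirc A) (-1/2)"
    using assms by (simp only: bcirc_tprod bcirc_tpowr)
  have "tpowr A (-1/2) \<star> B \<star> tpowr A (-1/2) \<in> TPD"
    unfolding TPD_iff M using assms by (intro posdef_congruence_powr) (simp_all add: TPD_iff)
  thus ?thesis
    using assms unfolding tensor_geometric_mean_def weighted_geometric_mean_def
    by (simp only: bcirc_tprod bcirc_tpowr M)
qed

lemma tensor_geometric_mean_TPD:
  "A \<in> TPD \<Longrightarrow> B \<in> TPD \<Longrightarrow> tensor_geometric_mean A B t \<in> TPD"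
  by (simp add: TPD_iff bcirc_tensor_geometric_mean posdef_weighted_geometric_mean)

lemma tensor_geometric_mean_endpoints:
  assumes "A \<in> TPD" "B \<in> TPD"
  shows "tensor_geometric_mean A B 0 = A" "tensor_geometric_mean A B 1 = B"
  unfolding bcirc_eq_iff[symmetric]
  using assms by (simp_all add: bcirc_tensor_geometric_mean weighted_geometric_mean_endpoints TPD_iff)

lemma TPD_imp_THerm: "A \<in> TPD \<Longrightarrow> A \<in> THerm"
  by (simp add: TPD_def)

lemma bounded_linear_tconj_transpose:
  "bounded_linear (tconj_transpose ::
    complex^'n^'m^'p::{finite,linorder} \<Rightarrow> complex^'m^'n^'p::{finite,linorder})"
  unfolding linear_conv_bounded_linear[symmetric]
  by (rule linearI) (simp_all add: tconj_transpose_def conj_transpose_def vec_eq_iff)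

lemma has_vector_derivative_within_unit_unique:
  assumes "t \<in> {0..1::real}" "(f has_vector_derivative D) (at t within {0..1})"
    "(g has_vector_derivative E) (at t within {0..1})" "\<And>s. s \<in> {0..1} \<Longrightarrow> f s = g s"
  shows "D = E"
proof -
  have "(f has_vector_derivative E) (at t within {0..1})"
    using has_vector_derivative_transform[OF assms(1) _ assms(3)] assms(4) by blast
  thus ?thesis
    using vector_derivative_unique_within_closed_interval[of 0 1 t f D E] assms(1,2) by simp
qed

text \<open>
  T-conjugation fixes the curve and is real linear, so it fixes the derivative.
\<close>

lemma derivative_in_THerm:
  assumes c: "(c has_vector_derivative D) (at t within {0..1})"
    and t: "t \<in> {0..1}" and herm: "\<And>s. s \<in> {0..1} \<Longrightarrow> c s \<in> THerm"
  shows "D \<in> THerm"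
proof -
  have "tconj_transpose D = D"
    by (rule has_vector_derivative_within_unit_unique[OF t
          bounded_linear.has_vector_derivative[OF bounded_linear_tconj_transpose c] c])
      (use herm in \<open>simp add: THerm_def\<close>)
  thus ?thesis by (simp add: THerm_def)
qed

lemma bcirc_has_vector_derivative_iff:
  fixes c :: "real \<Rightarrow> complex^'n^'n^'p::{finite,linorder}"
  shows "(c has_vector_derivative D) F \<longleftrightarrow>
    ((\<lambda>t. bcirc (c t)) has_vector_derivative bcirc D) F"
  using bounded_linear.has_vector_derivative[OF bounded_linear_bcirc, of c D F]
    bounded_linear.has_vector_derivative[OF bounded_linear_first_block_column,
      of "\<lambda>t. bcirc (c t)" "bcirc D" F]
  by auto

text \<open>
  A curve of block circulant matrices has block circulant derivatives, since these matrices form a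
  linear subspace.
\<close>

lemma bcirc_derivative:
  fixes c :: "real \<Rightarrow> complex^'n^'n^'p::{finite,linorder}"
  assumes "((\<lambda>t. bcirc (c t)) has_vector_derivative M) (at x)"
  shows "bcirc (first_block_column M) = M"
proof -
  have "((\<lambda>t. bcirc (first_block_column (bcirc (c t)))) has_vector_derivative
      bcirc (first_block_column M)) (at x)"
    by (intro bounded_linear.has_vector_derivative[OF bounded_linear_bcirc]
        bounded_linear.has_vector_derivative[OF bounded_linear_first_block_column] assms)
  hence "((\<lambda>t. bcirc (c t)) has_vector_derivative bcirc (first_block_column M)) (at x)" by simp
  thus ?thesis using assms by (rule vector_derivative_unique_at)
qed

text \<open>
  From \<open>\<gamma>' = \<gamma> K\<close> with \<open>K\<close> constant follow \<open>\<gamma>'' = \<gamma> K\<^sup>2\<close> and \<open>\<gamma>' \<gamma>\<^sup>-\<^sup>1 \<gamma>' = \<gamma> K \<gamma>\<^sup>-\<^sup>1 \<gamma> K = \<gamma> K\<^sup>2\<close>.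
\<close>

lemma geodesic_tensor_geometric_mean:
  fixes A B :: "complex^'n^'n^'p::{finite,linorder}"
  assumes A: "A \<in> TPD" and B: "B \<in> TPD"
  shows "geodesic tmetric THerm TPD (tensor_geometric_mean A B)"
proof -
  define G where "G t = weighted_geometric_mean (bcirc A) (bcirc B) t" for t
  let ?\<gamma> = "tensor_geometric_mean A B"
  have bG: "bcirc (?\<gamma> t) = G t" for t by (simp add: G_def bcirc_tensor_geometric_mean[OF A B])
  obtain K where K: "\<And>t. (G has_vector_derivative G t ** K) (at t)"
    unfolding G_def using weighted_geometric_mean_derivative[of "bcirc A" "bcirc B"] A B
    by (metis TPD_iff)
  define \<gamma>' where "\<gamma>' t = first_block_column (G t ** K)" for t
  define \<gamma>'' where "\<gamma>'' t = first_block_column (G t ** K ** K)" for t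
  have b1: "bcirc (\<gamma>' t) = G t ** K" for t
    unfolding \<gamma>'_def by (rule bcirc_derivative[of ?\<gamma> _ t]) (simp add: bG K)
  have K2: "((\<lambda>t. G t ** K) has_vector_derivative G t ** K ** K) (at t)" for t
    by (auto intro!: derivative_eq_intros K)
  have b2: "bcirc (\<gamma>'' t) = G t ** K ** K" for t
    unfolding \<gamma>''_def by (rule bcirc_derivative[of \<gamma>' _ t]) (simp add: b1 K2)
  have d1: "(?\<gamma> has_vector_derivative \<gamma>' t) (at t within {0..1})" for t
    unfolding bcirc_has_vector_derivative_iff[of ?\<gamma>] bG b1
    by (rule has_vector_derivative_at_within[OF K])
  have d2: "(\<gamma>' has_vector_derivative \<gamma>'' t) (at t within {0..1})" for t
    unfolding bcirc_has_vector_derivative_iff[of \<gamma>'] b1 b2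
    by (rule has_vector_derivative_at_within[OF K2])
  have "continuous_on {0..1} G"
    by (rule continuous_on_vector_derivative[OF has_vector_derivative_at_within[OF K]])
  hence "continuous_on {0..1} \<gamma>''"
    unfolding \<gamma>''_def
    by (intro bounded_linear.continuous_on[OF bounded_linear_first_block_column] continuous_intros)
  hence "C2_curve_in TPD ?\<gamma> \<gamma>' \<gamma>''"
    by (auto simp: C2_curve_in_def d1 d2 tensor_geometric_mean_TPD A B)
  moreover have "is_cov_accel tmetric THerm (?\<gamma> t) (\<gamma>' t) (\<gamma>'' t) 0" if t: "t \<in> {0..1}" for t
  proof -
    have TPD: "?\<gamma> s \<in> TPD" for s by (simp add: tensor_geometric_mean_TPD A B)
    have herm': "\<gamma>' s \<in> THerm" if "s \<in> {0..1}" for s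
      using derivative_in_THerm[OF d1 that] TPD TPD_imp_THerm by blast
    have herm'': "\<gamma>'' t \<in> THerm" using derivative_in_THerm[OF d2 t] herm' by blast
    have "invertible (G t)" using TPD[of t] by (simp add: bG[symmetric] TPD_iff posdef_invertible)
    hence "G t ** K ** (matrix_inv (G t) ** (G t ** K)) = G t ** K ** K"
      by (simp add: matrix_mul_assoc[of _ "G t"] matrix_inv_inverse)
    thus ?thesis
      unfolding is_cov_accel_tmetric_iff[OF TPD herm'[OF t] herm''] bG b1 b2
      by (simp add: matrix_mul_assoc bcirc_linear THerm_def
        linear_0[OF bounded_linear.linear[OF bounded_linear_tconj_transpose]])
  qed
  ultimately show ?thesis unfolding geodesic_def by blast
qed

lemma C2_curve_bcirc:
  fixes c :: "real \<Rightarrow> complex^'n^'n^'p::{finite,linorder}"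
  assumes "C2_curve_in TPD c c' c''" and t: "t \<in> {0..1}"
  shows "((\<lambda>t. bcirc (c t)) has_vector_derivative bcirc (c' t)) (at t within {0..1})"
    and "((\<lambda>t. bcirc (c' t)) has_vector_derivative bcirc (c'' t)) (at t within {0..1})"
    and "c t \<in> TPD" "posdef (bcirc (c t))" "c' t \<in> THerm" "c'' t \<in> THerm"
proof -
  note C = assms(1)[unfolded C2_curve_in_def, THEN conjunct1, rule_format]
  show "((\<lambda>t. bcirc (c t)) has_vector_derivative bcirc (c' t)) (at t within {0..1})"
    "((\<lambda>t. bcirc (c' t)) has_vector_derivative bcirc (c'' t)) (at t within {0..1})"
    using C[OF t] by (simp_all add: bcirc_has_vector_derivative_iff[symmetric])
  show "c t \<in> TPD" "posdef (bcirc (c t))" using C[OF t] by (simp_all add: TPD_iff)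
  have "c' s \<in> THerm" if "s \<in> {0..1}" for s
    by (rule derivative_in_THerm[of c _ s]) (use C that TPD_imp_THerm in auto)
  thus "c' t \<in> THerm" "c'' t \<in> THerm"
    using derivative_in_THerm[of c' "c'' t" t] C[OF t] t by simp_all
qed

lemma geodesic_unique:
  fixes c :: "real \<Rightarrow> complex^'n^'n^'p::{finite,linorder}"
  assumes c: "geodesic tmetric THerm TPD c" and t: "t \<in> {0..1}"
  shows "c t = tensor_geometric_mean (c 0) (c 1) t"
proof -
  obtain c' c'' where C2: "C2_curve_in TPD c c' c''"
    and acc: "\<And>t. t \<in> {0..1} \<Longrightarrow> is_cov_accel tmetric THerm (c t) (c' t) (c'' t) 0"
    using c unfolding geodesic_def by blast
  note C = C2_curve_bcirc[OF C2]
  have eq: "bcirc (c'' t) = bcirc (c' t) ** matrix_inv (bcirc (c t)) ** bcirc (c' t)"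
    if "t \<in> {0..1}" for t
    using acc[OF that] unfolding is_cov_accel_tmetric_iff[OF C(3,5,6)[OF that]] bcirc_linear by simp
  have "bcirc (c t) = weighted_geometric_mean (bcirc (c 0)) (bcirc (c 1)) t"
    by (rule geodesic_equation_unique[OF C(1) C(2) C(4) eq _ t])
      (use C(5)[of 0] in \<open>simp_all add: THerm_iff\<close>)
  thus ?thesis
    by (simp add: bcirc_eq_iff[symmetric] bcirc_tensor_geometric_mean C(3))
qed

text \<open>
  A constant curve is a geodesic.  For a regular curve the factor between the covariant
  acceleration and the velocity is given pointwise; writing it as the quotient \<open>f\<close> of two Euclidean inner
  products shows that it depends continuously on \<open>t\<close>, as required to integrate it.
\<close>

lemma unparametrized_geodesic_unique:
  fixes c :: "real \<Rightarrow> complex^'n^'n^'p::{finite,linorder}"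
  assumes c: "unparametrized_geodesic tmetric THerm TPD c"
  shows "reparametrization_of c (tensor_geometric_mean (c 0) (c 1))"
proof -
  obtain c' c'' where C2: "C2_curve_in TPD c c' c''"
    and cases: "(\<forall>t\<in>{0..1}. c' t = 0) \<or> (\<forall>t\<in>{0..1}. c' t \<noteq> 0 \<and>
      (\<exists>f. is_cov_accel tmetric THerm (c t) (c' t) (c'' t) (f *\<^sub>R c' t)))"
    using c unfolding unparametrized_geodesic_def by blast
  note C = C2_curve_bcirc[OF C2]
  from cases show ?thesis
  proof
    assume zero: "\<forall>t\<in>{0..1}. c' t = 0"
    have "c'' t = 0" if t: "t \<in> {0..1}" for t
      by (rule has_vector_derivative_within_unit_unique[OF t, of c' _ "\<lambda>_. 0"])
        (use C2 t zero in \<open>auto simp: C2_curve_in_def\<close>)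
    hence "is_cov_accel tmetric THerm (c t) (c' t) (c'' t) 0" if "t \<in> {0..1}" for t
      using C(5)[OF that] zero that unfolding is_cov_accel_tmetric_iff[OF C(3,5,6)[OF that]]
      by (simp add: bcirc_linear)
    hence "geodesic tmetric THerm TPD c" using C2 unfolding geodesic_def by blast
    hence c_eq: "c t = tensor_geometric_mean (c 0) (c 1) t" if "t \<in> {0..1}" for t
      using geodesic_unique that by blast
    show ?thesis
      unfolding reparametrization_of_def
    proof (intro exI conjI ballI)
      show "((\<lambda>t. t) has_real_derivative 1) (at t within {0..1})" for t :: real
        by (rule DERIV_ident)
      show "c t = tensor_geometric_mean (c 0) (c 1) t" if "t \<in> {0..1}" for t
        by (rule c_eq[OF that])
    qed auto
  next
    assume regular: "\<forall>t\<in>{0..1}. c' t \<noteq> 0 \<and>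
      (\<exists>f. is_cov_accel tmetric THerm (c t) (c' t) (c'' t) (f *\<^sub>R c' t))"
    define E where
      "E t = bcirc (c'' t) - bcirc (c' t) ** matrix_inv (bcirc (c t)) ** bcirc (c' t)" for t
    define f where "f t = (E t \<bullet> bcirc (c' t)) / (bcirc (c' t) \<bullet> bcirc (c' t))" for t
    have nz: "bcirc (c' t) \<noteq> 0" if "t \<in> {0..1}" for t
      using regular that bcirc_eq_iff[of "c' t" 0] by (simp add: bcirc_linear)
    have E: "E t = f t *\<^sub>R bcirc (c' t)" if t: "t \<in> {0..1}" for t
    proof -
      obtain r where "is_cov_accel tmetric THerm (c t) (c' t) (c'' t) (r *\<^sub>R c' t)"
        using regular t by blast
      hence "E t = r *\<^sub>R bcirc (c' t)"
        unfolding is_cov_accel_tmetric_iff[OF C(3,5,6)[OF t]] bcirc_linear E_def by simp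
      thus ?thesis using nz[OF t] by (simp add: f_def)
    qed
    have cont: "continuous_on {0..1} (\<lambda>t. bcirc (c t))" "continuous_on {0..1} (\<lambda>t. bcirc (c' t))"
      by (rule continuous_on_vector_derivative, rule C, assumption)+
    have "continuous_on {0..1} (\<lambda>t. bcirc (c'' t))"
      using C2 by (intro bounded_linear.continuous_on[OF bounded_linear_bcirc])
        (simp add: C2_curve_in_def)
    hence cont_f: "continuous_on {0..1} f"
      unfolding f_def E_def
      by (intro continuous_intros cont continuous_on_matrix_inv) (auto simp: nz C(4) posdef_invertible)
    have eq: "bcirc (c'' t) = bcirc (c' t) ** matrix_inv (bcirc (c t)) ** bcirc (c' t) +
        f t *\<^sub>R bcirc (c' t)" if "t \<in> {0..1}" for t
      using E[OF that] by (simp add: E_def algebra_simps)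
    have "reparametrization_of (\<lambda>t. bcirc (c t))
        (weighted_geometric_mean (bcirc (c 0)) (bcirc (c 1)))"
      by (rule pregeodesic_equation_unique[OF C(1) C(2) C(4) cont_f eq])
        (use C(5)[of 0] in \<open>simp_all add: THerm_iff\<close>)
    thus ?thesis
      unfolding reparametrization_of_def
      by (simp add: bcirc_eq_iff[symmetric] bcirc_tensor_geometric_mean C(3))
  qed
qed

theorem corollary4p1:
  fixes A B :: "complex^'n^'n^'p::{finite,linorder}"
  assumes "A \<in> TPD" and "B \<in> TPD"
  shows "let \<gamma> = (\<lambda>t. tpowr A (1/2) \<star> tpowr (tpowr A (-1/2) \<star> B \<star> tpowr A (-1/2)) t \<star> tpowr A (1/2))
    in geodesic tmetric THerm TPD \<gamma> \<and> \<gamma> 0 = A \<and> \<gamma> 1 = B \<and>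
       (\<forall>c. geodesic tmetric THerm TPD c \<and> c 0 = A \<and> c 1 = B \<longrightarrow> (\<forall>t\<in>{0..1}. c t = \<gamma> t)) \<and>
       (\<forall>c. unparametrized_geodesic tmetric THerm TPD c \<and> c 0 = A \<and> c 1 = B \<longrightarrow>
            reparametrization_of c \<gamma>)"
  unfolding tensor_geometric_mean_def[symmetric] Let_def
  using assms geodesic_tensor_geometric_mean[of A B] tensor_geometric_mean_endpoints[of A B]
    geodesic_unique unparametrized_geodesic_unique by blast

end
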